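(* Let $H$ be a 3-connected cubic graph that has no 3-decomposition and that has the minimum number of vertices among all 3-connected cubic graphs without a 3-decomposition. Then $H$ contains none of the following six graphs as a subgraph: the triangle $K_3$; the complete bipartite graph $K_{2,3}$; the Petersen graph with one vertex removed; the claw-square; the twin-house; the domino.
   Context: All graphs are finite and simple; cubic means 3-regular. A 3-decomposition of a graph $G$ is a partition of $E(G)$ into the edge sets of a spanning tree, a (possibly empty) 2-regular subgraph, and a (possibly empty) matching. The claw-square is the graph on vertices $a_1,a_2,a_3,a_4,b_1,b_2,b_3,c$ with edges $a_1a_2,a_2a_3,a_3a_4,a_4a_1$ (a 4-cycle), $cb_1,cb_2,cb_3$ and $b_1a_1,b_2a_2,b_3a_3$. The twin-house is the graph on vertices $p_1,\dots,p_6$ with edges $p_1p_2,p_1p_5,p_2p_6,p_5p_3,p_5p_4,p_6p_3,p_6p_4$. The domino is the $2\times 3$ grid graph, i.e. vertices $a_1,a_2,a_3,b_1,b_2,b_3$ with edges $a_1a_2,a_2a_3,b_1b_2,b_2b_3,a_1b_1,a_2b_2,a_3b_3$ (two 4-cycles sharing an edge). *)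

theory Defs
  imports Main
begin

definition graph :: "'a set \<Rightarrow> 'a set set \<Rightarrow> bool" where
  "graph V E \<longleftrightarrow> finite V \<and> (\<forall>e\<in>E. \<exists>u v. u \<noteq> v \<and> u \<in> V \<and> v \<in> V \<and> e = {u, v})"

definition degree :: "'a set set \<Rightarrow> 'a \<Rightarrow> nat" where
  "degree E v = card {e\<in>E. v \<in> e}"

definition cubic :: "'a set \<Rightarrow> 'a set set \<Rightarrow> bool" where
  "cubic V E \<longleftrightarrow> (\<forall>v\<in>V. degree E v = 3)"

definition adj :: "'a set set \<Rightarrow> 'a \<Rightarrow> 'a \<Rightarrow> bool" where
  "adj E u v \<longleftrightarrow> {u, v} \<in> E"

definition connected :: "'a set \<Rightarrow> 'a set set \<Rightarrow> bool" where
  "connected V E \<longleftrightarrow> V \<noteq> {} \<and> (\<forall>u\<in>V. \<forall>v\<in>V. (adj E)\<^sup>*\<^sup>* u v)"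

definition del_verts :: "'a set set \<Rightarrow> 'a set \<Rightarrow> 'a set set" where
  "del_verts E S = {e\<in>E. e \<inter> S = {}}"

definition k_connected :: "nat \<Rightarrow> 'a set \<Rightarrow> 'a set set \<Rightarrow> bool" where
  "k_connected k V E \<longleftrightarrow> card V > k \<and>
     (\<forall>S. S \<subseteq> V \<and> card S < k \<longrightarrow> connected (V - S) (del_verts E S))"

definition is_cycle :: "'a set set \<Rightarrow> 'a list \<Rightarrow> bool" where
  "is_cycle E vs \<longleftrightarrow> length vs \<ge> 3 \<and> distinct vs \<and>
     (\<forall>i<length vs. {vs ! i, vs ! ((i + 1) mod length vs)} \<in> E)"

definition acyclic_edges :: "'a set set \<Rightarrow> bool" where
  "acyclic_edges E \<longleftrightarrow> \<not> (\<exists>vs. is_cycle E vs)"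

definition spanning_tree :: "'a set \<Rightarrow> 'a set set \<Rightarrow> 'a set set \<Rightarrow> bool" where
  "spanning_tree V E T \<longleftrightarrow> T \<subseteq> E \<and> connected V T \<and> acyclic_edges T"

definition two_regular_sub :: "'a set \<Rightarrow> 'a set set \<Rightarrow> 'a set set \<Rightarrow> bool" where
  "two_regular_sub V E C \<longleftrightarrow> C \<subseteq> E \<and> (\<forall>v\<in>V. degree C v = 0 \<or> degree C v = 2)"

definition matching :: "'a set set \<Rightarrow> 'a set set \<Rightarrow> bool" where
  "matching E M \<longleftrightarrow> M \<subseteq> E \<and> (\<forall>e\<in>M. \<forall>f\<in>M. e \<noteq> f \<longrightarrow> e \<inter> f = {})"

definition three_decomposition ::
  "'a set \<Rightarrow> 'a set set \<Rightarrow> 'a set set \<Rightarrow> 'a set set \<Rightarrow> 'a set set \<Rightarrow> bool" where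
  "three_decomposition V E T C M \<longleftrightarrow>
     T \<union> C \<union> M = E \<and> T \<inter> C = {} \<and> T \<inter> M = {} \<and> C \<inter> M = {} \<and>
     spanning_tree V E T \<and> two_regular_sub V E C \<and> matching E M"

definition has_3_decomposition :: "'a set \<Rightarrow> 'a set set \<Rightarrow> bool" where
  "has_3_decomposition V E \<longleftrightarrow> (\<exists>T C M. three_decomposition V E T C M)"

definition contains_subgraph ::
  "'a set \<Rightarrow> 'a set set \<Rightarrow> 'b set \<Rightarrow> 'b set set \<Rightarrow> bool" where
  "contains_subgraph V E V' E' \<longleftrightarrow>
     (\<exists>f. inj_on f V' \<and> f ` V' \<subseteq> V \<and> (\<forall>e\<in>E'. f ` e \<in> E))"

definition mk_edges :: "(nat \<times> nat) list \<Rightarrow> nat set set" where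
  "mk_edges ps = (\<lambda>(u, v). {u, v}) ` set ps"

definition K3_V :: "nat set" where "K3_V = {0, 1, 2}"
definition K3_E :: "nat set set" where "K3_E = mk_edges [(0,1),(1,2),(2,0)]"

definition K23_V :: "nat set" where "K23_V = {0..4}"
definition K23_E :: "nat set set" where
  "K23_E = mk_edges [(0,2),(0,3),(0,4),(1,2),(1,3),(1,4)]"

text \<open>Petersen graph on 0..9 (outer 5-cycle 0..4, spokes i -- i+5, inner pentagram
  i+5 -- ((i+2) mod 5)+5), with vertex 9 removed.\<close>
definition Petersen_V :: "nat set" where "Petersen_V = {0..9}"
definition Petersen_E :: "nat set set" where
  "Petersen_E = mk_edges [(0,1),(1,2),(2,3),(3,4),(4,0),
                          (0,5),(1,6),(2,7),(3,8),(4,9),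
                          (5,7),(7,9),(9,6),(6,8),(8,5)]"
definition PetersenMinus_V :: "nat set" where "PetersenMinus_V = Petersen_V - {9}"
definition PetersenMinus_E :: "nat set set" where
  "PetersenMinus_E = del_verts Petersen_E {9}"

text \<open>Claw-square: a1..a4 = 0..3, b1..b3 = 4..6, c = 7.\<close>
definition ClawSquare_V :: "nat set" where "ClawSquare_V = {0..7}"
definition ClawSquare_E :: "nat set set" where
  "ClawSquare_E = mk_edges [(0,1),(1,2),(2,3),(3,0),(7,4),(7,5),(7,6),(4,0),(5,1),(6,2)]"

text \<open>Twin-house: p1..p6 = 1..6.\<close>
definition TwinHouse_V :: "nat set" where "TwinHouse_V = {1..6}"
definition TwinHouse_E :: "nat set set" where
  "TwinHouse_E = mk_edges [(1,2),(1,5),(2,6),(5,3),(5,4),(6,3),(6,4)]"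

text \<open>Domino: a1..a3 = 0..2, b1..b3 = 3..5.\<close>
definition Domino_V :: "nat set" where "Domino_V = {0..5}"
definition Domino_E :: "nat set set" where
  "Domino_E = mk_edges [(0,1),(1,2),(3,4),(4,5),(0,3),(1,4),(2,5)]"

end

theory Submission
  imports Defs
begin

text \<open>In a minimal counterexample every occurrence of one of the configurations is joined to the rest by three or
  four edges. Replace it by a single vertex, a 4-cycle, or a single edge carrying two of the outer edges
  at each end. In terms of edge cuts, which for cubic graphs decide 3-connectivity, the
  smaller graph is again 3-connected, so it has a 3-decomposition. Only the labels of the
  joining edges and the partition of their outer ends into components of the outer forest
  matter for continuing this decomposition through the original configuration; these states are finitely many, and
  each of them can be continued.\<close>

section \<open>Reachability and trees\<close>

text \<open>When a decomposition of the smaller graph is restricted to the outside, each component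
  of the outer forest still contains an outer end, because the whole tree is connected through the
  pole. Contracting these components therefore turns the tree condition into a test on a small
  graph. Cuts suit the replacement because the boundary of a set is a sum of a part outside and a
  part at the pole, and only the second part changes. Two obstacles shape the rest. A copy of a
  configuration need not be induced: the free edges of two of its nodes may be one and the same
  edge. Excluding this uses the absence of triangles, and at two places the absence of K_{2,3}, so
  these two come before the configurations with four outer edges. Moreover the smaller graph must be
  simple and 3-connected. A single vertex fails when only one vertex lies outside; the H fails when
  at most one outside edge joins its two sides. A 4-cycle never fails, but for the domino it leaves
  one partition of the outer ends open.\<close>

abbreviation reach :: "'a set set \<Rightarrow> 'a \<Rightarrow> 'a \<Rightarrow> bool" where
  "reach E \<equiv> (adj E)\<^sup>*\<^sup>*"

lemma adj_sym: "adj E u v \<Longrightarrow> adj E v u"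
  by (simp add: adj_def insert_commute)

lemma reach_sym: "reach E u v \<Longrightarrow> reach E v u"
  by (induction rule: rtranclp_induct) (auto intro: adj_sym converse_rtranclp_into_rtranclp)

lemma reach_mono: "reach E u v \<Longrightarrow> E \<subseteq> F \<Longrightarrow> reach F u v"
  by (erule rtranclp_mono[THEN predicate2D, rotated]) (auto simp: adj_def)

lemma reach_edge: "{u, v} \<in> E \<Longrightarrow> reach E u v"
  by (simp add: adj_def r_into_rtranclp)

lemma reach_insert:
  "reach (insert {u, v} E) a b \<longleftrightarrow>
    reach E a b \<or> reach E a u \<and> reach E v b \<or> reach E a v \<and> reach E u b"
  (is "?L \<longleftrightarrow> ?R a b")
proof
  assume ?L
  then show "?R a b"
  proof (induction rule: rtranclp_induct)
    case (step b c)
    have "{b, c} = {u, v} \<or> adj E b c" using step(2) by (auto simp: adj_def)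
    then show ?case
    proof
      assume "adj E b c"
      with step.IH show ?thesis by (meson rtranclp.rtrancl_into_rtrancl)
    next
      assume "{b, c} = {u, v}"
      then have "b = u \<and> c = v \<or> b = v \<and> c = u" by (auto simp: doubleton_eq_iff)
      with step.IH show ?thesis by (meson rtranclp.rtrancl_refl rtranclp_trans reach_sym)
    qed
  qed simp
next
  let ?F = "insert {u, v} E"
  have "reach ?F x y" if "reach E x y" for x y using that by (rule reach_mono) auto
  moreover have "reach ?F u v" "reach ?F v u" by (auto intro!: reach_edge simp: insert_commute)
  moreover assume "?R a b"
  ultimately show ?L by (meson rtranclp_trans)
qed

lemma reach_simple_path:
  assumes "reach E u v"
  obtains vs where "vs \<noteq> []" "hd vs = u" "last vs = v" "distinct vs" "successively (adj E) vs"
proof -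
  from assms have "\<exists>vs. vs \<noteq> [] \<and> hd vs = u \<and> last vs = v \<and> distinct vs \<and> successively (adj E) vs"
  proof (induction rule: converse_rtranclp_induct)
    case base
    show ?case by (rule exI[of _ "[v]"]) simp
  next
    case (step u w)
    then obtain vs where vs: "vs \<noteq> []" "hd vs = w" "last vs = v" "distinct vs" "successively (adj E) vs"
      by blast
    show ?case
    proof (cases "u \<in> set vs")
      case True
      then obtain xs ys where "vs = xs @ u # ys" by (meson split_list)
      with vs show ?thesis
        by (intro exI[of _ "u # ys"]) (auto simp: successively_append_iff)
    next
      case False
      with vs step(1) show ?thesis
        by (intro exI[of _ "u # vs"]) (auto simp: successively_Cons)
    qed
  qed
  with that show thesis by blast
qed

section \<open>Forests and bridges\<close>

lemma acyclic_subset: "acyclic_edges E \<Longrightarrow> F \<subseteq> E \<Longrightarrow> acyclic_edges F"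
  by (auto simp: acyclic_edges_def is_cycle_def)

text \<open>Cycles as vertex lists are awkward under insertion of edges, whereas bridges are
  expressed by reachability. A simple path from u to v avoiding the edge uv closes up to a cycle,
  and a cycle without its closing edge is such a path.\<close>

lemma acyclic_iff_bridges:
  "acyclic_edges E \<longleftrightarrow> (\<forall>u v. u \<noteq> v \<longrightarrow> {u, v} \<in> E \<longrightarrow> \<not> reach (E - {{u, v}}) u v)"
proof (intro iffI allI impI notI)
  fix u v
  assume ac: "acyclic_edges E" and uv: "u \<noteq> v" "{u, v} \<in> E" "reach (E - {{u, v}}) u v"
  obtain vs where vs: "vs \<noteq> []" "hd vs = u" "last vs = v" "distinct vs"
      "successively (adj (E - {{u, v}})) vs"
    using reach_simple_path[OF uv(3)] .
  have step: "{vs ! i, vs ! Suc i} \<in> E - {{u, v}}" if "Suc i < length vs" for i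
    using vs(5) that by (simp add: successively_conv_nth adj_def)
  have u: "vs ! 0 = u" and v: "vs ! (length vs - 1) = v"
    using vs(1-3) by (simp_all add: hd_conv_nth last_conv_nth)
  have "length vs \<noteq> 1" using u v uv(1) by auto
  \<comment> \<open>A path on two vertices would be the edge uv itself, which has been
    removed.\<close>
  moreover have "length vs \<noteq> 2" using step[of 0] u v by auto
  moreover have "length vs \<noteq> 0" using vs(1) by simp
  ultimately have len: "length vs \<ge> 3" by linarith
  have "{vs ! i, vs ! ((i + 1) mod length vs)} \<in> E" if "i < length vs" for i
  proof (cases "Suc i < length vs")
    case True
    then show ?thesis using step[of i] by simp
  next
    case False
    with that have "Suc i = length vs" by linarith
    then have "i = length vs - 1" "(i + 1) mod length vs = 0" by auto
    then show ?thesis using u v uv(2) by (simp add: insert_commute)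
  qed
  with len vs(4) have "is_cycle E vs" by (simp add: is_cycle_def)
  with ac show False by (auto simp: acyclic_edges_def)
next
  assume br: "\<forall>u v. u \<noteq> v \<longrightarrow> {u, v} \<in> E \<longrightarrow> \<not> reach (E - {{u, v}}) u v"
  show "acyclic_edges E"
    unfolding acyclic_edges_def
  proof
    assume "\<exists>vs. is_cycle E vs"
    then obtain vs where len: "length vs \<ge> 3" and d: "distinct vs"
      and c: "\<And>i. i < length vs \<Longrightarrow> {vs ! i, vs ! ((i + 1) mod length vs)} \<in> E"
      by (auto simp: is_cycle_def)
    let ?l = "length vs - 1"
    let ?E = "E - {{vs ! 0, vs ! ?l}}"
    have "reach ?E (vs ! 0) (vs ! i)" if "i < length vs" for i
      using that
    proof (induction i)
      case (Suc i)
      have "{vs ! i, vs ! Suc i} \<in> E" using c[of i] Suc.prems by simp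
      moreover have "{vs ! i, vs ! Suc i} \<noteq> {vs ! 0, vs ! ?l}"
      proof -
        have "vs ! a = vs ! b \<longleftrightarrow> a = b" if "a < length vs" "b < length vs" for a b
          using d that by (simp add: nth_eq_iff_index_eq)
        moreover have "0 < length vs" "?l < length vs" "i \<noteq> ?l" "i = 0 \<Longrightarrow> Suc i \<noteq> ?l"
          using len Suc.prems by auto
        ultimately show ?thesis using Suc.prems unfolding doubleton_eq_iff
          by (metis Suc_lessD nat.distinct(1))
      qed
      ultimately show ?case using Suc by (auto simp: adj_def intro: rtranclp.rtrancl_into_rtrancl)
    qed simp
    then have "reach ?E (vs ! 0) (vs ! ?l)" using len by simp
    moreover have "{vs ! 0, vs ! ?l} \<in> E"
    proof -
      have "?l < length vs" "?l + 1 = length vs" using len by linarith+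
      then show ?thesis using c[of ?l] by (simp add: insert_commute)
    qed
    moreover have "vs ! 0 \<noteq> vs ! ?l"
    proof -
      have "?l < length vs" "0 < length vs" "?l \<noteq> 0" using len by auto
      then show ?thesis using d nth_eq_iff_index_eq[of vs 0 ?l] by auto
    qed
    ultimately show False using br by blast
  qed
qed

text \<open>If an edge ab of \<open>E\<close> stops being a bridge, the detour between its ends runs
  through uv. The two remaining pieces of the detour together with ab join u to v inside
  \<open>E\<close>.\<close>

lemma acyclic_insert:
  assumes "acyclic_edges E" "u \<noteq> v" "{u, v} \<notin> E"
  shows "acyclic_edges (insert {u, v} E) \<longleftrightarrow> \<not> reach E u v"
proof
  assume "acyclic_edges (insert {u, v} E)"
  moreover have "insert {u, v} E - {{u, v}} = E" using assms(3) by auto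
  ultimately show "\<not> reach E u v" using assms(2) by (auto simp: acyclic_iff_bridges)
next
  assume nr: "\<not> reach E u v"
  show "acyclic_edges (insert {u, v} E)"
    unfolding acyclic_iff_bridges
  proof (intro allI impI notI)
    fix a b
    assume ab: "a \<noteq> b" "{a, b} \<in> insert {u, v} E" "reach (insert {u, v} E - {{a, b}}) a b"
    show False
    proof (cases "{a, b} = {u, v}")
      case True
      then have "insert {u, v} E - {{a, b}} = E" using assms(3) by auto
      with ab(3) have "reach E a b" by simp
      moreover have "a = u \<and> b = v \<or> a = v \<and> b = u" using True by (simp add: doubleton_eq_iff)
      ultimately show False using nr reach_sym[of E v u] by blast
    next
      case False
      let ?E = "E - {{a, b}}"
      have inE: "{a, b} \<in> E" using ab(2) False by auto
      then have no: "\<not> reach ?E a b" using assms(1) ab(1) by (auto simp: acyclic_iff_bridges)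
      have "insert {u, v} E - {{a, b}} = insert {u, v} ?E" using False by auto
      with ab(3) no have "reach ?E a u \<and> reach ?E v b \<or> reach ?E a v \<and> reach ?E u b"
        by (simp add: reach_insert)
      then have "reach E a u \<and> reach E v b \<or> reach E a v \<and> reach E u b"
        by (meson Diff_subset reach_mono)
      moreover have "reach E a b" "reach E b a"
        using inE by (auto intro!: reach_edge simp: insert_commute)
      ultimately have "reach E u v" by (meson rtranclp_trans reach_sym)
      with nr show False by simp
    qed
  qed
qed

section \<open>Spanning trees by merging component names\<close>

fun edge :: "'a \<times> 'a \<Rightarrow> 'a set" where
  "edge (a, b) = {a, b}"

text \<open>The values in \<^term>\<open>cs\<close> name the components found so far. Each pair merges two components and is
  rejected if both ends already lie in the same one; at the end one component must be left.\<close>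

fun tree_check :: "'c list \<Rightarrow> ('c \<times> 'c) list \<Rightarrow> bool" where
  "tree_check cs [] \<longleftrightarrow> (\<forall>x\<in>set cs. x = hd cs)"
| "tree_check cs ((i, j) # ps) \<longleftrightarrow> (if i = j then False else
     let s = (\<lambda>x. if x = j then i else x) in tree_check (map s cs) (map (map_prod s s) ps))"

definition classifies :: "'a set \<Rightarrow> 'a set set \<Rightarrow> ('a \<Rightarrow> 'c) \<Rightarrow> bool" where
  "classifies V E q \<longleftrightarrow> (\<forall>u\<in>V. \<forall>v\<in>V. q u = q v \<longleftrightarrow> reach E u v)"

lemma classifies_insert:
  assumes q: "classifies V E q" and uv: "u \<in> V" "v \<in> V"
  shows "classifies V (insert {u, v} E) ((\<lambda>x. if x = q v then q u else x) \<circ> q)"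
  unfolding classifies_def
proof (intro ballI)
  fix a b assume ab: "a \<in> V" "b \<in> V"
  have q': "q x = q y \<longleftrightarrow> reach E x y" if "x \<in> V" "y \<in> V" for x y
    using q that by (simp add: classifies_def)
  show "((\<lambda>x. if x = q v then q u else x) \<circ> q) a = ((\<lambda>x. if x = q v then q u else x) \<circ> q) b
    \<longleftrightarrow> reach (insert {u, v} E) a b"
    using ab uv by (auto simp: reach_insert q'[symmetric])
qed

text \<open>Invariant: \<open>E\<close> is the forest built so far and \<open>q\<close> names its
  components. The start may be any forest, so the outer forest of a decomposition enters the test
  only through the names of its components.\<close>

lemma tree_check_iff:
  assumes "classifies V E q" "acyclic_edges E" "set cs = q ` V" "V \<noteq> {}"
    and "\<And>a b. (a, b) \<in> set ps \<Longrightarrow> a \<in> V \<and> b \<in> V \<and> a \<noteq> b"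
    and "distinct (map edge ps)" "edge ` set ps \<inter> E = {}"
  shows "tree_check cs (map (map_prod q q) ps) \<longleftrightarrow>
    acyclic_edges (E \<union> edge ` set ps) \<and> connected V (E \<union> edge ` set ps)"
  using assms
proof (induction ps arbitrary: E q cs)
  case Nil
  have "cs \<noteq> []" using Nil.prems by auto
  then have "hd cs \<in> q ` V" using Nil.prems(3) by (metis hd_in_set)
  then have "(\<forall>x\<in>set cs. x = hd cs) \<longleftrightarrow> (\<forall>u\<in>V. \<forall>v\<in>V. q u = q v)"
    unfolding Nil.prems(3) by (metis imageE imageI)
  then show ?case using Nil.prems by (auto simp: connected_def classifies_def)
next
  case (Cons p ps)
  obtain u v where p: "p = (u, v)" by (cases p)
  have uv: "u \<in> V" "v \<in> V" "u \<noteq> v" using Cons.prems(5)[of u v] p by auto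
  have nE: "{u, v} \<notin> E" using Cons.prems(7) p by auto
  have quv: "q u = q v \<longleftrightarrow> reach E u v" using Cons.prems(1) uv by (simp add: classifies_def)
  let ?E = "insert {u, v} E"
  have E: "E \<union> edge ` set (p # ps) = ?E \<union> edge ` set ps" by (auto simp: p)
  show ?case
  proof (cases "q u = q v")
    case True
    then have "\<not> acyclic_edges ?E"
      using acyclic_insert[OF Cons.prems(2) uv(3) nE] quv by simp
    \<comment> \<open>Early rejection is sound because a cycle survives all later edges.\<close>
    then have "\<not> acyclic_edges (?E \<union> edge ` set ps)"
      using acyclic_subset by (metis Un_upper1)
    then show ?thesis using True E by (simp add: p)
  next
    case False
    define s where "s = (\<lambda>x. if x = q v then q u else x)"
    have "tree_check (map s cs) (map (map_prod (s \<circ> q) (s \<circ> q)) ps) \<longleftrightarrow>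
      acyclic_edges (?E \<union> edge ` set ps) \<and> connected V (?E \<union> edge ` set ps)"
    proof (rule Cons.IH)
      show "classifies V ?E (s \<circ> q)"
        unfolding s_def by (rule classifies_insert) (use Cons.prems(1) uv in auto)
      show "acyclic_edges ?E" using acyclic_insert[OF Cons.prems(2) uv(3) nE] quv False by simp
      show "set (map s cs) = (s \<circ> q) ` V" using Cons.prems(3) by (simp add: image_comp)
      show "edge ` set ps \<inter> ?E = {}" using Cons.prems(6,7) p by (auto simp: image_iff)
      show "distinct (map edge ps)" using Cons.prems(6) by simp
      show "\<And>a b. (a, b) \<in> set ps \<Longrightarrow> a \<in> V \<and> b \<in> V \<and> a \<noteq> b"
        
      proof -
        fix a b assume "(a, b) \<in> set ps"
        then show "a \<in> V \<and> b \<in> V \<and> a \<noteq> b" using Cons.prems(5)[of a b] by simp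
      qed
      show "V \<noteq> {}" by fact
    qed
    moreover have "map (map_prod (s \<circ> q) (s \<circ> q)) ps = map (map_prod s s) (map (map_prod q q) ps)"
      by (auto simp: map_prod_def)
    ultimately show ?thesis using False E by (simp add: p s_def Let_def del: map_map)
  qed
qed

section \<open>Edge cuts and 3-connectivity\<close>

text \<open>Serves degrees and cuts alike: with \<open>P\<close> selecting the edges at a vertex or
  those crossing a set, the contribution of a pole becomes the length of a filtered list.\<close>

lemma card_filter_edges:
  assumes "finite A" "distinct (map edge ps)" "edge ` set ps \<inter> A = {}"
  shows "card {e \<in> A \<union> edge ` set ps. P e} = card {e \<in> A. P e} + length (filter (\<lambda>p. P (edge p)) ps)"
  using assms
proof (induction ps)
  case (Cons p ps)
  have eq: "{e \<in> A \<union> edge ` set (p # ps). P e} =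
    (if P (edge p) then insert (edge p) {e \<in> A \<union> edge ` set ps. P e} else {e \<in> A \<union> edge ` set ps. P e})"
    by auto
  have "finite {e \<in> A \<union> edge ` set ps. P e}" using Cons.prems(1) by simp
  moreover have "edge p \<notin> A \<union> edge ` set ps" using Cons.prems by auto
  moreover have "card {e \<in> A \<union> edge ` set ps. P e} = card {e \<in> A. P e} + length (filter (\<lambda>p. P (edge p)) ps)"
    using Cons by auto
  ultimately show ?case unfolding eq by simp
qed simp

definition boundary :: "'a set set \<Rightarrow> 'a set \<Rightarrow> 'a set set" where
  "boundary E S = {e \<in> E. e \<inter> S \<noteq> {} \<and> \<not> e \<subseteq> S}"

definition three_edge_connected :: "'a set \<Rightarrow> 'a set set \<Rightarrow> bool" where
  "three_edge_connected V E \<longleftrightarrow> (\<forall>S. S \<subset> V \<longrightarrow> S \<noteq> {} \<longrightarrow> card (boundary E S) \<ge> 3)"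

lemma graph_finite_edges: "graph V E \<Longrightarrow> finite E"
proof -
  assume g: "graph V E"
  then have "E \<subseteq> Pow V" by (auto simp: graph_def)
  with g show ?thesis by (meson finite_Pow_iff finite_subset graph_def)
qed

lemma graph_edge_eq:
  assumes "graph V E" "e \<in> E" "v \<in> e" "w \<in> e" "v \<noteq> w"
  shows "e = {v, w}"
proof -
  from assms(1,2) obtain x y where "e = {x, y}" unfolding graph_def by blast
  with assms(3-5) show ?thesis by auto
qed

lemma boundary_singleton: "graph V E \<Longrightarrow> boundary E {v} = {e \<in> E. v \<in> e}"
  by (fastforce simp: boundary_def graph_def)

lemma reach_del_verts_closed:
  assumes "graph V E" "reach (del_verts E W) u v" "u \<in> A"
    and "boundary E A \<subseteq> {e. e \<inter> W \<noteq> {}}"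
  shows "v \<in> A"
  using assms(2,3)
proof (induction rule: rtranclp_induct)
  case (step v w)
  then have "{v, w} \<in> E" "{v, w} \<inter> W = {}" "v \<in> A" by (auto simp: adj_def del_verts_def)
  with assms(4) show ?case by (auto simp: boundary_def)
qed

text \<open>In a cut with at most two edges, the ends inside S are at most two vertices, and they
  separate what remains of S from the complement. If nothing remains, S has one or two vertices, and
  at least three or four edges leave it since the graph is cubic and simple.\<close>

lemma k_connected_imp_three_edge_connected:
  assumes g: "graph V E" and c: "cubic V E" and k: "k_connected 3 V E"
  shows "three_edge_connected V E"
  unfolding three_edge_connected_def
proof (intro allI impI)
  fix S assume S: "S \<subset> V" "S \<noteq> {}"
  have fE: "finite E" using g by (rule graph_finite_edges)
  have fS: "finite S" using g S by (meson finite_subset graph_def psubset_imp_subset)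
  have fB: "finite (boundary E S)" using fE by (simp add: boundary_def)
  show "card (boundary E S) \<ge> 3"
  proof (rule ccontr)
    assume "\<not> ?thesis"
    then have small: "card (boundary E S) \<le> 2" by simp
    have "\<exists>a. a \<in> e \<and> a \<in> S" if "e \<in> boundary E S" for e using that by (auto simp: boundary_def)
    then obtain a where a: "\<And>e. e \<in> boundary E S \<Longrightarrow> a e \<in> e \<and> a e \<in> S" by metis
    let ?A = "a ` boundary E S"
    have A: "?A \<subseteq> S" "card ?A \<le> 2" "finite ?A"
      using a small fB card_image_le[of "boundary E S" a] by auto
    show False
    proof (cases "?A = S")
      case False
      with A obtain u where u: "u \<in> S - ?A" by blast
      from S obtain w where w: "w \<in> V - S" by blast
      have "connected (V - ?A) (del_verts E ?A)"
        using k A S unfolding k_connected_def by (metis le_imp_less_Suc numeral_2_eq_2 numeral_3_eq_3 psubset_imp_subset subset_trans)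
      then have "reach (del_verts E ?A) u w"
      proof -
        have "u \<in> V - ?A" "w \<in> V - ?A" using u w S A(1) by blast+
        moreover note \<open>connected (V - ?A) (del_verts E ?A)\<close>
        ultimately show ?thesis unfolding connected_def by blast
      qed
      moreover have "boundary E S \<subseteq> {e. e \<inter> ?A \<noteq> {}}" using a by blast
      ultimately have "w \<in> S" using reach_del_verts_closed[OF g] u by blast
      with w show False by simp
    next
      case True
      have deg: "card {e \<in> E. v \<in> e} = 3" if "v \<in> S" for v
        using c S that by (auto simp: cubic_def degree_def)
      have "card S \<noteq> 0" using S fS by simp
      then consider "card S = 1" | "card S = 2" using A True by fastforce
      then show False
      proof cases
        case 1
        then obtain v where "S = {v}" by (auto simp: card_1_singleton_iff)
        with deg[of v] small boundary_singleton[OF g, of v] show False by simp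
      next
        case 2
        then obtain v w where vw: "S = {v, w}" "v \<noteq> w" by (auto simp: card_2_iff)
        let ?F = "\<lambda>v. {e \<in> E. v \<in> e} - {{v, w}}" and ?G = "{e \<in> E. w \<in> e} - {{v, w}}"
        have e: "e = {v, w}" if "e \<in> E" "v \<in> e" "w \<in> e" for e
          using graph_edge_eq[OF g that vw(2)] .
        have "?F v \<union> ?G \<subseteq> boundary E S"
        proof
          fix e assume eF: "e \<in> ?F v \<union> ?G"
          then obtain x y where "e = {x, y}" "x \<noteq> y" using g unfolding graph_def by blast
          then have "\<not> e \<subseteq> {v, w}" using eF by auto
          with eF show "e \<in> boundary E S" by (auto simp: boundary_def vw(1))
        qed
        then have "card (?F v \<union> ?G) \<le> 2" using fB small by (meson card_mono le_trans)
        moreover have "?F v \<inter> ?G = {}" using e by blast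
        then have "card (?F v \<union> ?G) = card (?F v) + card ?G"
          using fE by (intro card_Un_disjoint) auto
        moreover have "card (?F v) \<ge> 2" "card ?G \<ge> 2"
          using deg[of v] deg[of w] vw(1) by (auto simp: card_Diff_singleton_if)
        ultimately show False by linarith
      qed
    qed
  qed
qed

text \<open>Let W be a separator with at most two vertices, A a component it leaves and B the other
  vertices. A and B each send at least three edges to W. One vertex of W, or two adjacent ones,
  cannot absorb six edges; two nonadjacent ones can only with equality everywhere, and then parity
  excludes it.\<close>

lemma three_edge_connected_imp_k_connected:
  assumes g: "graph V E" and c: "cubic V E" and t: "three_edge_connected V E" and V: "card V > 3"
  shows "k_connected 3 V E"
  unfolding k_connected_def
proof (intro conjI allI impI)
  show "card V > 3" by fact
  fix W assume W: "W \<subseteq> V \<and> card W < 3"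
  have fE: "finite E" using g by (rule graph_finite_edges)
  have fV: "finite V" using g by (simp add: graph_def)
  have fW: "finite W" using W fV by (meson finite_subset)
  show "connected (V - W) (del_verts E W)"
    unfolding connected_def
  proof (intro conjI ballI)
    show "V - W \<noteq> {}" using V W fW card_mono[of W V] by auto
    fix u v assume u: "u \<in> V - W" and v: "v \<in> V - W"
    show "reach (del_verts E W) u v"
    proof (rule ccontr)
      assume nr: "\<not> ?thesis"
      define A where "A = {x \<in> V - W. reach (del_verts E W) u x}"
      define B where "B = V - W - A"
      have uA: "u \<in> A" and vB: "v \<in> B" using u v nr by (auto simp: A_def B_def)
      have AB: "e \<inter> A = {} \<or> e \<inter> B = {}" if "e \<in> E" for e
      proof (rule ccontr)
        assume "\<not> ?thesis"
        then obtain a b where ab: "a \<in> e" "a \<in> A" "b \<in> e" "b \<in> B" by blast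
        then have "a \<noteq> b" "a \<notin> W" "b \<notin> W" by (auto simp: A_def B_def)
        moreover from this have "e = {a, b}" using graph_edge_eq[OF g that] ab by blast
        ultimately have "adj (del_verts E W) a b"
          using that by (auto simp: adj_def del_verts_def)
        moreover have "reach (del_verts E W) u a" using ab by (simp add: A_def)
        ultimately have "reach (del_verts E W) u b" by (rule rtranclp.rtrancl_into_rtrancl[rotated])
        with ab show False unfolding A_def B_def by blast
      qed
      have two: "\<exists>x y. x \<noteq> y \<and> x \<in> V \<and> y \<in> V \<and> e = {x, y}" if "e \<in> E" for e
        using g that by (auto simp: graph_def)
      define N where "N S s = {e \<in> E. s \<in> e \<and> e \<inter> S \<noteq> {}}" for S s
      have fN: "finite (N S s)" for S s using fE by (simp add: N_def)
      have cut: "card (boundary E S) \<ge> 3" if "S \<subseteq> V" "x \<in> S" "y \<in> V - S" for S x y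
        using t that unfolding three_edge_connected_def by blast
      have cutA: "card (boundary E A) \<ge> 3" and cutB: "card (boundary E B) \<ge> 3"
        using cut[of A u v] cut[of B v u] uA vB by (auto simp: A_def B_def)
      have VW: "x \<in> A \<or> x \<in> B \<or> x \<in> W" if "x \<in> V" for x using that by (auto simp: B_def)
      have eV: "x \<in> V" if "x \<in> e" "e \<in> E" for x e using two[OF that(2)] that(1) by blast
      have bA: "boundary E A \<subseteq> (\<Union>s\<in>W. N A s)"
      proof
        fix e assume "e \<in> boundary E A"
        then obtain p q where pq: "e \<in> E" "p \<in> e" "p \<in> A" "q \<in> e" "q \<notin> A"
          by (auto simp: boundary_def)
        then have "q \<in> W" using VW[of q] eV[of q e] AB[of e] by blast
        with pq show "e \<in> (\<Union>s\<in>W. N A s)" by (auto simp: N_def)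
      qed
      have bB: "boundary E B \<subseteq> (\<Union>s\<in>W. N B s)"
      proof
        fix e assume "e \<in> boundary E B"
        then obtain p q where pq: "e \<in> E" "p \<in> e" "p \<in> B" "q \<in> e" "q \<notin> B"
          by (auto simp: boundary_def)
        then have "q \<in> W" using VW[of q] eV[of q e] AB[of e] by blast
        with pq show "e \<in> (\<Union>s\<in>W. N B s)" by (auto simp: N_def)
      qed
      have deg: "card (N A s) + card (N B s) \<le> 3" if "s \<in> W" for s
      proof -
        have "N A s \<inter> N B s = {}" using AB by (auto simp: N_def)
        then have "card (N A s) + card (N B s) = card (N A s \<union> N B s)"
          using fN by (simp add: card_Un_disjoint)
        also have "\<dots> \<le> card {e \<in> E. s \<in> e}"
          using fE by (intro card_mono) (auto simp: N_def)
        finally show ?thesis using c that W by (auto simp: cubic_def degree_def)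
      qed
      have "card W = 0 \<or> card W = 1 \<or> card W = 2" using W by linarith
      then consider "W = {}" | s where "W = {s}" | s r where "W = {s, r}" "s \<noteq> r"
        using fW by (auto simp: card_1_singleton_iff card_2_iff)
      then show False
      proof cases
        case 1
        with bA cutA show False by auto
      next
        case (2 s)
        then have "card (boundary E A) \<le> card (N A s)" "card (boundary E B) \<le> card (N B s)"
          using bA bB fN by (auto intro!: card_mono)
        with deg[of s] cutA cutB 2 show False by auto
      next
        case (3 s r)
        have le: "card X \<le> card (N S x) + card (N S' y)" if "X \<subseteq> N S x \<union> N S' y" for X S S' x y
          using that fN card_mono[of "N S x \<union> N S' y" X] card_Un_le[of "N S x" "N S' y"] by simp
        have sr: "s \<in> V" "r \<in> V" "s \<notin> A" "r \<notin> A" "s \<notin> B" "r \<notin> B" using W 3 by (auto simp: A_def B_def)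
        \<comment> \<open>The cut around A together with one vertex x of W consists of edges from x
          to B, edges from the other vertex y to A, and possibly xy.\<close>
        have mixed: "3 \<le> card (N B x) + card (N A y) + (if {x, y} \<in> E then 1 else 0)"
          if "W = {x, y}" "x \<noteq> y" for x y
        proof -
          have xy: "x \<in> V" "y \<in> V" "y \<notin> A" "v \<notin> insert x A" using that W vB v by (auto simp: A_def B_def)
          have "boundary E (insert x A) \<subseteq> (N B x \<union> N A y) \<union> (E \<inter> {{x, y}})"
          proof
            fix e assume e: "e \<in> boundary E (insert x A)"
            then have eE: "e \<in> E" by (simp add: boundary_def)
            from e obtain p q where pq: "p \<in> e" "q \<in> e" "p \<in> insert x A" "q \<notin> insert x A"
              by (auto simp: boundary_def)
            with two[OF eE] have epq: "e = {p, q}" "q \<in> V" by auto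
            have "q = y \<or> q \<in> B" using pq epq that by (auto simp: B_def)
            then show "e \<in> (N B x \<union> N A y) \<union> (E \<inter> {{x, y}})"
              using AB[OF eE] pq epq eE by (auto simp: N_def)
          qed
          then have "card (boundary E (insert x A)) \<le> card ((N B x \<union> N A y) \<union> (E \<inter> {{x, y}}))"
            using fN by (intro card_mono) auto
          also have "\<dots> \<le> card (N B x) + card (N A y) + card (E \<inter> {{x, y}})"
            by (meson add_mono_thms_linordered_semiring(3) card_Un_le le_trans)
          also have "card (E \<inter> {{x, y}}) = (if {x, y} \<in> E then 1 else 0)" by auto
          finally show ?thesis
            using cut[of "insert x A" u v] xy uA v by (auto simp: A_def)
        qed
        have h1: "3 \<le> card (N A s) + card (N A r)" "3 \<le> card (N B s) + card (N B r)"
          using bA bB cutA cutB 3 le[of "boundary E A" A s A r] le[of "boundary E B" B s B r] by auto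
        have h2: "card (N A s) + card (N B s) \<le> 3" "card (N A r) + card (N B r) \<le> 3"
          using deg 3 by auto
        have h3: "3 \<le> card (N B s) + card (N A r) + (if {s, r} \<in> E then 1 else 0)"
          "3 \<le> card (N B r) + card (N A s) + (if {s, r} \<in> E then 1 else 0)"
          using mixed[of s r] mixed[of r s] 3 by (simp_all add: insert_commute)
        have h4: "card (N A s) + card (N B s) \<le> 2" "card (N A r) + card (N B r) \<le> 2"
          if sr': "{s, r} \<in> E"
        proof -
          have *: "card (N A x) + card (N B x) \<le> 2" if "W = {x, y}" "{x, y} \<in> E" for x y
          proof -
            have x: "x \<in> V" using that W by auto
            have "N A x \<inter> N B x = {}" using AB by (auto simp: N_def)
            then have "card (N A x) + card (N B x) = card (N A x \<union> N B x)"
              using fN by (simp add: card_Un_disjoint)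
            also have "\<dots> \<le> card ({e \<in> E. x \<in> e} - {{x, y}})"
              using fE that by (intro card_mono) (auto simp: N_def A_def B_def)
            also have "\<dots> = 2" using c x that by (simp add: cubic_def degree_def)
            finally show ?thesis .
          qed
          show "card (N A s) + card (N B s) \<le> 2" using *[of s r] 3 sr' by simp
          show "card (N A r) + card (N B r) \<le> 2" using *[of r s] 3 sr' by (simp add: insert_commute)
        qed
        show False
        proof (cases "{s, r} \<in> E")
          case True
          with h4 h1 show False by fastforce
        next
          case False
          with h3 have "3 \<le> card (N B s) + card (N A r)" "3 \<le> card (N B r) + card (N A s)" by simp_all
          \<comment> \<open>Let s send a edges to A and b to B, and r send c to A and d to B. All
            inequalities are tight, whence a + b = a + c = b + c = 3, which has no integer
            solution.\<close>
          with h1 h2 show False by presburger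
        qed
      qed
    qed
  qed
qed

section \<open>Poles and their labellings\<close>

datatype label = Tr | Cy | Ma

fun sel :: "label \<Rightarrow> 'b list \<Rightarrow> label list \<Rightarrow> 'b list" where
  "sel c (p # ps) (l # ls) = (if l = c then p # sel c ps ls else sel c ps ls)"
| "sel c [] ls = []"
| "sel c ps [] = []"

lemma set_sel_subset: "set (sel c ps ls) \<subseteq> set ps"
  by (induction c ps ls rule: sel.induct) auto

lemma sel_map: "sel c (map h ps) ls = map h (sel c ps ls)"
  by (induction c ps ls rule: sel.induct) auto

lemma sel_append:
  "length ps = length ls \<Longrightarrow> sel c (ps @ qs) (ls @ ms) = sel c ps ls @ sel c qs ms"
  by (induction c ps ls rule: sel.induct) auto

lemma sel_labelling: "sel c ps (map g ps) = filter (\<lambda>p. g p = c) ps"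
  by (induction ps) auto

lemma distinct_sel: "distinct (map h ps) \<Longrightarrow> distinct (map h (sel c ps ls))"
proof (induction c ps ls rule: sel.induct)
  case (1 c p ps l ls)
  then have "h p \<notin> h ` set (sel c ps ls)" using set_sel_subset[of c ps ls] by auto
  with 1 show ?case by simp
qed auto

lemma sel_cover:
  "length ps = length ls \<Longrightarrow> set (sel Tr ps ls) \<union> set (sel Cy ps ls) \<union> set (sel Ma ps ls) = set ps"
  by (induction ps ls rule: list_induct2) (use label.exhaust in auto)

lemma sel_disjoint:
  "distinct (map h ps) \<Longrightarrow> c \<noteq> d \<Longrightarrow> h ` set (sel c ps ls) \<inter> h ` set (sel d ps ls) = {}"
proof (induction c ps ls rule: sel.induct)
  case (1 c p ps l ls)
  have "h p \<notin> h ` set (sel e ps ls)" for e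
    using 1(3) set_sel_subset[of e ps ls] by auto
  with 1 show ?case by (auto split: if_splits)
qed auto

lemma distinct_map_edges:
  assumes "inj_on f A" "\<And>a b. (a, b) \<in> set ps \<Longrightarrow> a \<in> A \<and> b \<in> A" "distinct (map edge ps)"
  shows "distinct (map edge (map (map_prod f f) ps))"
proof -
  have "edge \<circ> map_prod f f = (`) f \<circ> edge" by auto
  moreover have "inj_on ((`) f) (set (map edge ps))"
  proof (rule inj_onI)
    fix B D assume "B \<in> set (map edge ps)" "D \<in> set (map edge ps)" "f ` B = f ` D"
    moreover have "B \<subseteq> A" if "B \<in> set (map edge ps)" for B
      using that assms(2) by fastforce
    ultimately show "B = D" using assms(1) by (meson inj_on_image_eq_iff)
  qed
  ultimately show ?thesis using assms(3) by (simp add: distinct_map comp_inj_on_iff[symmetric])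
qed

definition occ :: "'a \<Rightarrow> ('a \<times> 'a) list \<Rightarrow> nat" where
  "occ v ps = length (filter (\<lambda>(a, b). v = a \<or> v = b) ps)"

text \<open>A pole is a cubic graph on the nodes \<^term>\<open>{..<n}\<close> with \<^term>\<open>k\<close> dangling edges: the \<^term>\<open>i\<close>-th one leaves
  node \<^term>\<open>ts ! i\<close>, and \<^term>\<open>ies\<close> lists the edges inside. The code \<^term>\<open>n\<close> stands for all outer ends.\<close>

definition pole :: "nat \<Rightarrow> nat \<Rightarrow> nat list \<Rightarrow> (nat \<times> nat) list \<Rightarrow> bool" where
  "pole k n ts ies \<longleftrightarrow> 0 < n \<and> length ts = k \<and> (\<forall>t\<in>set ts. t < n) \<and>
     (\<forall>(a, b)\<in>set ies. a < n \<and> b < n \<and> a \<noteq> b) \<and> distinct (map edge ies) \<and>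
     (\<forall>x\<in>set [0..<n]. occ x (zip ts (replicate k n) @ ies) = 3)"

text \<open>The cycle and matching conditions at the nodes of a pole depend on labels alone, so all
  outer ends may share one code. The same conditions at the outer ends belong to
  \<open>state\<close>.\<close>

definition locally_ok :: "nat \<Rightarrow> (nat \<times> nat) list \<Rightarrow> label list \<Rightarrow> bool" where
  "locally_ok n ps ls \<longleftrightarrow> (\<forall>x\<in>set [0..<n].
     (let c = occ x (sel Cy ps ls) in if c = 0 then True else c = 2) \<and> occ x (sel Ma ps ls) \<le> 1)"

text \<open>The outer end of the \<^term>\<open>i\<close>-th dangling edge is contracted to the node \<^term>\<open>n + r ! i\<close>, which represents
  the component of the outer forest containing it.\<close>

definition spanning_ok :: "nat \<Rightarrow> nat list \<Rightarrow> (nat \<times> nat) list \<Rightarrow> nat list \<Rightarrow> label list \<Rightarrow> bool" where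
  "spanning_ok n ts ies r ls \<longleftrightarrow>
     tree_check ([0..<n] @ map ((+) n) r) (sel Tr (zip ts (map ((+) n) r) @ ies) ls)"

text \<open>Makes the matching condition local to vertices, so that, like 2-regularity, it splits
  into a condition at outer vertices and one at pole nodes.\<close>

lemma matching_iff_degree:
  assumes "graph V E" "M \<subseteq> E"
  shows "matching E M \<longleftrightarrow> (\<forall>v\<in>V. degree M v \<le> 1)"
proof -
  have fM: "finite {e \<in> M. v \<in> e}" for v
    using graph_finite_edges[OF assms(1)] assms(2) by (simp add: finite_subset)
  have V: "v \<in> V" if "v \<in> e" "e \<in> M" for v e
  proof -
    have "e \<in> E" using that(2) assms(2) by auto
    then obtain x y where xy: "x \<in> V" "y \<in> V" "e = {x, y}"
      using assms(1) unfolding graph_def by meson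
    from that(1) xy show ?thesis by auto
  qed
  have deg: "degree M v \<le> 1 \<longleftrightarrow> (\<forall>e\<in>M. \<forall>f\<in>M. v \<in> e \<longrightarrow> v \<in> f \<longrightarrow> e = f)" for v
    using fM[of v] unfolding degree_def by (auto simp: card_le_Suc0_iff_eq)
  show ?thesis
  proof
    assume "matching E M"
    then show "\<forall>v\<in>V. degree M v \<le> 1" unfolding deg matching_def by blast
  next
    assume *: "\<forall>v\<in>V. degree M v \<le> 1"
    have "e \<inter> f = {}" if "e \<in> M" "f \<in> M" "e \<noteq> f" for e f
    proof (rule ccontr)
      assume "e \<inter> f \<noteq> {}"
      then obtain v where v: "v \<in> e" "v \<in> f" by blast
      with * V that(1) have "degree M v \<le> 1" by blast
      with v that show False unfolding deg by blast
    qed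
    with assms(2) show "matching E M" by (simp add: matching_def)
  qed
qed

text \<open>The graph \<^term>\<open>(Y, F)\<close> lies outside the pole, \<^term>\<open>ys ! i\<close> is the outer end of the \<^term>\<open>i\<close>-th dangling
  edge, and \<^term>\<open>f\<close> places the nodes of a pole. Replacing a pole keeps all of these, so that the smaller
  pole uses some of the vertices of the larger one.\<close>

locale outside =
  fixes Y :: "'a set" and F :: "'a set set" and ys :: "'a list" and f :: "nat \<Rightarrow> 'a" and N :: nat
  assumes graph_F: "graph Y F" and ys_Y: "set ys \<subseteq> Y"
    and inj_f: "inj_on f {..<N}" and f_Y: "f ` {..<N} \<inter> Y = {}"
begin

definition verts :: "nat \<Rightarrow> 'a set" where
  "verts n = Y \<union> f ` {..<n}"

definition links :: "nat list \<Rightarrow> (nat \<times> nat) list \<Rightarrow> ('a \<times> 'a) list" where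
  "links ts ies = zip (map f ts) ys @ map (map_prod f f) ies"

definition edges :: "nat list \<Rightarrow> (nat \<times> nat) list \<Rightarrow> 'a set set" where
  "edges ts ies = F \<union> edge ` set (links ts ies)"

text \<open>\<open>T\<close>, \<open>C\<close>, \<open>M\<close> are the parts of a decomposition
  outside, \<open>ls\<close> labels the dangling edges, and \<open>r\<close> has equal entries
  exactly where the outer ends lie in the same component of \<open>T\<close>. Dangling edges are
  counted with multiplicity since an outer vertex may carry several of them.\<close>

definition state :: "'a set set \<Rightarrow> 'a set set \<Rightarrow> 'a set set \<Rightarrow> label list \<Rightarrow> nat list \<Rightarrow> bool" where
  "state T C M ls r \<longleftrightarrow>
     T \<union> C \<union> M = F \<and> T \<inter> C = {} \<and> T \<inter> M = {} \<and> C \<inter> M = {} \<and> acyclic_edges T \<and>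
     length ls = length ys \<and> length r = length ys \<and>
     (\<forall>i<length ys. \<forall>j<length ys. r ! i = r ! j \<longleftrightarrow> reach T (ys ! i) (ys ! j)) \<and>
     (\<forall>y\<in>Y. \<exists>i<length ys. reach T y (ys ! i)) \<and>
     (\<forall>y\<in>Y. degree C y + count_list (zip ys ls) (y, Cy) \<in> {0, 2}) \<and>
     (\<forall>y\<in>Y. degree M y + count_list (zip ys ls) (y, Ma) \<le> 1)"

lemma F_subset: "e \<in> F \<Longrightarrow> e \<subseteq> Y"
  using graph_F by (auto simp: graph_def)

lemma finite_F: "finite F"
  using graph_F by (rule graph_finite_edges)

lemma reach_F:
  assumes "reach T u v" "T \<subseteq> F"
  shows "u = v \<or> u \<in> Y \<and> v \<in> Y"
  using assms(1)
proof (induction rule: rtranclp_induct)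
  case (step v w)
  then have "{v, w} \<in> F" using assms(2) by (auto simp: adj_def)
  with step.IH F_subset show ?case by blast
qed simp

end

text \<open>A dangling matching edge may be moved to the tree: its outer end has two tree edges already, so only
  the component of that end, which is recorded in the state, matters. Without this freedom the Petersen
  graph minus a vertex could not replace a vertex.\<close>

fun upgrade :: "label list \<Rightarrow> label list \<Rightarrow> bool" where
  "upgrade [] ms \<longleftrightarrow> ms = []"
| "upgrade (l # ls) [] \<longleftrightarrow> False"
| "upgrade (l # ls) (m # ms) \<longleftrightarrow> (if l = m \<or> l = Ma \<and> m = Tr then upgrade ls ms else False)"

lemma upgrade_length: "upgrade ls ms \<Longrightarrow> length ms = length ls"
  by (induction ls ms rule: upgrade.induct) (auto split: if_splits)

lemma upgrade_count:
  assumes "upgrade ls ms" "length ys = length ls"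
  shows "count_list (zip ys ms) (y, Cy) = count_list (zip ys ls) (y, Cy)"
    and "count_list (zip ys ms) (y, Ma) \<le> count_list (zip ys ls) (y, Ma)"
proof -
  have "count_list (zip ys ms) (y, Cy) = count_list (zip ys ls) (y, Cy) \<and>
    count_list (zip ys ms) (y, Ma) \<le> count_list (zip ys ls) (y, Ma)"
    using assms
  proof (induction ls ms arbitrary: ys rule: upgrade.induct)
    case (3 l ls m ms)
    then obtain z zs where "ys = z # zs" by (cases ys) auto
    with "3.prems" "3.IH"[of zs] show ?case by (auto split: if_splits)
  qed auto
  then show "count_list (zip ys ms) (y, Cy) = count_list (zip ys ls) (y, Cy)"
    and "count_list (zip ys ms) (y, Ma) \<le> count_list (zip ys ls) (y, Ma)" by auto
qed

text \<open>The labels occur in a state only in the degree bounds at outer vertices. Changing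
  \<open>Ma\<close> to \<open>Tr\<close> leaves the cycle counts alone and can only lower the
  matching counts.\<close>

lemma (in outside) state_upgrade:
  assumes st: "state T C M ls r" and up: "upgrade ls ls'"
  shows "state T C M ls' r"
proof -
  have len: "length ys = length ls" "length ls' = length ys"
    using st upgrade_length[OF up] by (auto simp: state_def)
  have "\<forall>y\<in>Y. degree M y + count_list (zip ys ls') (y, Ma) \<le> 1"
  proof
    fix y assume "y \<in> Y"
    then have "degree M y + count_list (zip ys ls) (y, Ma) \<le> 1" using st by (simp add: state_def)
    with upgrade_count(2)[OF up len(1), of y] show "degree M y + count_list (zip ys ls') (y, Ma) \<le> 1"
      by linarith
  qed
  with st len(2) upgrade_count(1)[OF up len(1)] show ?thesis by (simp add: state_def)
qed

text \<open>Distinctness of \<open>zip ts ys\<close> forbids parallel dangling edges, yet lets two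
  of them share a node of the pole or an outer end.\<close>

locale attached = outside +
  fixes n :: nat and ts :: "nat list" and ies :: "(nat \<times> nat) list"
  assumes pole: "pole (length ys) n ts ies" and n_N: "n \<le> N" and distinct_terminals: "distinct (zip ts ys)"
begin

abbreviation "L \<equiv> links ts ies"

lemma pole_facts:
  shows n_pos: "0 < n" and length_ts: "length ts = length ys" and ts_n: "t \<in> set ts \<Longrightarrow> t < n"
    and ies_n: "(a, b) \<in> set ies \<Longrightarrow> a < n \<and> b < n \<and> a \<noteq> b"
    and distinct_ies: "distinct (map edge ies)"
    and cubic_pole: "x < n \<Longrightarrow> occ x (zip ts (replicate (length ys) n) @ ies) = 3"
  using pole by (auto simp: pole_def)

lemma f_eq_iff: "a < n \<Longrightarrow> b < n \<Longrightarrow> f a = f b \<longleftrightarrow> a = b"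
  using inj_f n_N by (auto simp: inj_on_def)

lemma f_notin_Y: "a < n \<Longrightarrow> f a \<notin> Y"
proof
  assume "a < n" "f a \<in> Y"
  then have "f a \<in> f ` {..<N} \<inter> Y" using n_N by simp
  with f_Y show False by simp
qed

lemma links_alt: "L = map (map_prod f id) (zip ts ys) @ map (map_prod f f) ies"
  by (simp add: links_def zip_map1 map_prod_def)

lemma link_cases:
  assumes "p \<in> set L"
  obtains t y where "p = (f t, y)" "t < n" "y \<in> Y" "(t, y) \<in> set (zip ts ys)"
  | a b where "p = (f a, f b)" "(a, b) \<in> set ies" "a < n" "b < n" "a \<noteq> b"
proof -
  from assms consider t y where "p = (f t, y)" "(t, y) \<in> set (zip ts ys)"
    | a b where "p = (f a, f b)" "(a, b) \<in> set ies"
    by (auto simp: links_alt)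
  then show thesis
  proof cases
    case 1
    moreover have "t < n" "y \<in> Y" using 1(2) ts_n ys_Y by (auto dest: set_zip_leftD set_zip_rightD)
    ultimately show thesis using that(1) by blast
  next
    case 2
    then show thesis using that(2) ies_n by blast
  qed
qed

lemma link_edge_notin_F: "p \<in> set L \<Longrightarrow> edge p \<notin> F"
proof (erule link_cases)
  fix t y assume "p = (f t, y)" "t < n"
  then show "edge p \<notin> F" using F_subset[of "edge p"] f_notin_Y[of t] by auto
next
  fix a b assume "p = (f a, f b)" "a < n"
  then show "edge p \<notin> F" using F_subset[of "edge p"] f_notin_Y[of a] by auto
qed

lemma links_disjoint: "edge ` set L \<inter> F = {}"
  using link_edge_notin_F by blast

lemma link_verts: "(a, b) \<in> set L \<Longrightarrow> a \<in> verts n \<and> b \<in> verts n \<and> a \<noteq> b"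
proof (erule link_cases)
  fix t y assume "(a, b) = (f t, y)" "t < n" "y \<in> Y"
  then show ?thesis using f_notin_Y[of t] by (auto simp: verts_def)
next
  fix x y assume "(a, b) = (f x, f y)" "x < n" "y < n" "x \<noteq> y"
  then show ?thesis using f_eq_iff[of x y] by (auto simp: verts_def)
qed

lemma distinct_links: "distinct (map edge L)"
proof -
  have "inj_on (edge \<circ> map_prod f id) (set (zip ts ys))"
  proof (rule inj_onI, clarify)
    fix t y t' y'
    assume *: "(t, y) \<in> set (zip ts ys)" "(t', y') \<in> set (zip ts ys)"
      and eq: "(edge \<circ> map_prod f id) (t, y) = (edge \<circ> map_prod f id) (t', y')"
    have "t < n" "y \<in> Y" "t' < n" "y' \<in> Y"
      using * ts_n ys_Y by (auto dest: set_zip_leftD set_zip_rightD)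
    with eq f_notin_Y f_eq_iff show "t = t' \<and> y = y'" by (auto simp: doubleton_eq_iff)
  qed
  then have "distinct (map edge (map (map_prod f id) (zip ts ys)))"
    using distinct_terminals by (simp add: distinct_map)
  moreover have "distinct (map edge (map (map_prod f f) ies))"
    using inj_f n_N ies_n distinct_ies by (intro distinct_map_edges[of f "{..<N}"]) fastforce+
  moreover have "edge (map_prod f id p) \<noteq> edge (map_prod f f r)"
    if "p \<in> set (zip ts ys)" "r \<in> set ies" for p r
  proof -
    obtain t y a b where pr: "p = (t, y)" "r = (a, b)" by (metis surj_pair)
    then have "y \<in> Y" "a < n" "b < n" using that ys_Y ies_n by (auto dest: set_zip_rightD)
    then show ?thesis using f_notin_Y pr by (auto simp: doubleton_eq_iff)
  qed
  then have "edge ` map_prod f id ` set (zip ts ys) \<inter> edge ` map_prod f f ` set ies = {}"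
    by (intro equals0I) (elim IntE imageE, metis)
  ultimately show ?thesis unfolding links_alt map_append distinct_append set_map by (intro conjI)
qed

lemma finite_verts: "finite (verts n)"
  using graph_F by (simp add: verts_def graph_def)

lemma graph_edges: "graph (verts n) (edges ts ies)"
  unfolding graph_def
proof (intro conjI ballI)
  fix e assume "e \<in> edges ts ies"
  then consider "e \<in> F" | p where "p \<in> set L" "e = edge p" by (auto simp: edges_def)
  then show "\<exists>u v. u \<noteq> v \<and> u \<in> verts n \<and> v \<in> verts n \<and> e = {u, v}"
  proof cases
    case 1
    then show ?thesis using graph_F by (fastforce simp: graph_def verts_def)
  next
    case (2 p)
    obtain a b where "p = (a, b)" by (cases p)
    then show ?thesis using 2 link_verts[of a b] by auto
  qed
qed (rule finite_verts)

lemma count_edges: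
  assumes "A \<subseteq> F" "set S \<subseteq> set L" "distinct (map edge S)"
  shows "card {e \<in> A \<union> edge ` set S. P e} = card {e \<in> A. P e} + length (filter (\<lambda>p. P (edge p)) S)"
  using assms links_disjoint finite_F by (intro card_filter_edges) (auto intro: finite_subset)

text \<open>A code inverts \<open>f\<close> on the pole and sends the outside to numbers from
  \<open>n\<close> on, so that the links become the number pairs on which the finite checks run.
  Local counts use the constant \<open>n\<close> outside; the tree test uses component
  names.\<close>

definition codes :: "('a \<Rightarrow> nat) \<Rightarrow> bool" where
  "codes q \<longleftrightarrow> (\<forall>a<n. q (f a) = a) \<and> (\<forall>y\<in>Y. n \<le> q y)"

lemma codes_exist:
  assumes "\<And>y. y \<in> Y \<Longrightarrow> n \<le> z y"
  obtains q where "codes q" "\<And>y. y \<in> Y \<Longrightarrow> q y = z y"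
proof
  let ?q = "\<lambda>v. if v \<in> Y then z v else the_inv_into {..<N} f v"
  show "codes ?q"
    using assms f_notin_Y n_N inj_f by (auto simp: codes_def the_inv_into_f_f)
qed simp

lemma map_links:
  assumes "codes q"
  shows "map (map_prod q q) L = zip ts (map q ys) @ ies"
proof -
  have "map_prod q q (map_prod f id p) = map_prod id q p" if "p \<in> set (zip ts ys)" for p
  proof -
    obtain t y where p: "p = (t, y)" by (cases p)
    then have "t < n" using that ts_n by (auto dest: set_zip_leftD)
    with p assms show ?thesis by (simp add: codes_def)
  qed
  then have "map (map_prod q q) (map (map_prod f id) (zip ts ys)) = map (map_prod id q) (zip ts ys)"
    by simp
  also have "\<dots> = zip ts (map q ys)" by (simp add: zip_map2 map_prod_def)
  finally have "map (map_prod q q) (map (map_prod f id) (zip ts ys)) = zip ts (map q ys)" .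
  moreover have "map (map_prod q q) (map (map_prod f f) ies) = ies"
    using assms ies_n by (auto simp: codes_def intro!: map_idI)
  ultimately show ?thesis unfolding links_alt by simp
qed

lemma degree_inner:
  assumes "codes q" "A \<subseteq> F" "set S \<subseteq> set L" "distinct (map edge S)" "x < n"
  shows "degree (A \<union> edge ` set S) (f x) = occ x (map (map_prod q q) S)"
proof -
  have "card {e \<in> A. f x \<in> e} = 0"
    using assms(2,5) F_subset f_notin_Y by (metis (no_types, lifting) card.empty empty_Collect_eq subsetD)
  moreover have "f x \<in> edge p \<longleftrightarrow> (case map_prod q q p of (a, b) \<Rightarrow> x = a \<or> x = b)" if "p \<in> set S" for p
  proof -
    have "p \<in> set L" using that assms(3) by auto
    then show ?thesis
    proof (cases rule: link_cases)
      case (1 t y)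
      with assms(1,5) f_notin_Y[of x] show ?thesis by (force simp: codes_def f_eq_iff)
    next
      case (2 a b)
      with assms(1,5) show ?thesis by (auto simp: codes_def f_eq_iff)
    qed
  qed
  then have "filter (\<lambda>p. f x \<in> edge p) S = filter (\<lambda>p. case map_prod q q p of (a, b) \<Rightarrow> x = a \<or> x = b) S"
    by (rule filter_cong[OF refl])
  ultimately show ?thesis
    unfolding degree_def count_edges[OF assms(2-4)] occ_def by (simp add: filter_map comp_def)
qed

lemma degree_outer:
  assumes "y \<in> Y" "A \<subseteq> F" "length ls = length ys"
  shows "degree (A \<union> edge ` set (sel c L (ls @ ms))) y = degree A y + count_list (zip ys ls) (y, c)"
proof -
  have *: "length (filter (\<lambda>p. y \<in> edge p) (sel c (zip us zs) ls)) = count_list (zip zs ls) (y, c)"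
    if "length us = length zs" "length zs = length ls" "y \<notin> set us" for us zs and ls :: "label list"
    using that by (induction us zs ls rule: list_induct3) auto
  have "y \<notin> set (map f ts)" using f_notin_Y ts_n assms(1) by auto
  then have "length (filter (\<lambda>p. y \<in> edge p) (sel c (zip (map f ts) ys) ls)) = count_list (zip ys ls) (y, c)"
    using assms(3) length_ts by (intro *) auto
  moreover have "filter (\<lambda>p. y \<in> edge p) (sel c (map (map_prod f f) ies) ms) = []"
    unfolding filter_empty_conv using set_sel_subset[of c "map (map_prod f f) ies" ms] f_notin_Y ies_n assms(1)
    by fastforce
  moreover have "sel c L (ls @ ms) = sel c (zip (map f ts) ys) ls @ sel c (map (map_prod f f) ies) ms"
    unfolding links_def using assms(3) length_ts by (intro sel_append) simp
  ultimately show ?thesis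
    unfolding degree_def
    by (subst count_edges[OF assms(2) set_sel_subset distinct_sel[OF distinct_links]]) simp
qed

end

section \<open>Gluing decompositions\<close>

lemma sel_replicate: "length ps = k \<Longrightarrow> sel c ps (replicate k c) = ps"
  by (induction ps arbitrary: k) auto

lemma count_list_zip_replicate: "length ys = k \<Longrightarrow> count_list (zip ys (replicate k c)) (y, c) = count_list ys y"
  by (induction ys arbitrary: k) auto

context attached
begin

lemma codes_const:
  obtains q where "codes q" "map (map_prod q q) L = zip ts (replicate (length ys) n) @ ies"
proof -
  obtain q where q: "codes q" "\<And>y. y \<in> Y \<Longrightarrow> q y = n" using codes_exist[of "\<lambda>_. n"] by auto
  have "map q ys = map (\<lambda>_. n) ys" using q(2) ys_Y by (intro map_cong) auto
  also have "\<dots> = replicate (length ys) n" by (rule map_replicate_const)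
  finally show thesis using that[OF q(1)] map_links[OF q(1)] by simp
qed

lemma degree_edges_inner:
  assumes "x < n"
  shows "degree (edges ts ies) (f x) = 3"
proof -
  obtain q where q: "codes q" "map (map_prod q q) L = zip ts (replicate (length ys) n) @ ies"
    by (rule codes_const)
  show ?thesis
    unfolding edges_def using degree_inner[OF q(1) subset_refl subset_refl distinct_links assms] q(2)
      cubic_pole[OF assms] by simp
qed

lemma degree_edges_outer:
  assumes "y \<in> Y"
  shows "degree (edges ts ies) y = degree F y + count_list ys y"
proof -
  have "sel Tr L (replicate (length ys) Tr @ replicate (length ies) Tr) = L"
    unfolding replicate_add[symmetric] using length_ts by (intro sel_replicate) (simp add: links_def)
  with degree_outer[OF assms subset_refl, of "replicate (length ys) Tr" Tr "replicate (length ies) Tr"]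
  show ?thesis by (simp add: edges_def count_list_zip_replicate)
qed

lemma cubic_edges:
  assumes "\<And>y. y \<in> Y \<Longrightarrow> degree F y + count_list ys y = 3"
  shows "cubic (verts n) (edges ts ies)"
  using assms degree_edges_inner degree_edges_outer by (auto simp: cubic_def verts_def)

lemma card_boundary_edges:
  "card (boundary (edges ts ies) S) =
    card (boundary F (S \<inter> Y)) + length (filter (\<lambda>(a, b). (a \<in> S) \<noteq> (b \<in> S)) L)"
proof -
  have "boundary F (S \<inter> Y) = {e \<in> F. e \<inter> S \<noteq> {} \<and> \<not> e \<subseteq> S}"
    using F_subset by (fastforce simp: boundary_def)
  moreover have "edge p \<inter> S \<noteq> {} \<and> \<not> edge p \<subseteq> S \<longleftrightarrow> (case p of (a, b) \<Rightarrow> (a \<in> S) \<noteq> (b \<in> S))" for p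
    by (cases p) auto
  ultimately show ?thesis
    unfolding edges_def boundary_def[of "F \<union> edge ` set L"]
    using count_edges[OF subset_refl subset_refl distinct_links, of "\<lambda>e. e \<inter> S \<noteq> {} \<and> \<not> e \<subseteq> S"]
    by simp
qed

text \<open>An outer vertex gets the name of an outer end that it reaches, and a pole node is a
  component of its own since \<open>T\<close> lies outside. As every outer vertex reaches an outer
  end, \<open>[0..<n] @ map ((+) n) r\<close> misses no component.\<close>

lemma state_classifier:
  assumes st: "state T C M ls r"
  obtains q where "codes q" "map q ys = map ((+) n) r" "classifies (verts n) T q"
    "set ([0..<n] @ map ((+) n) r) = q ` verts n"
proof -
  have TF: "T \<subseteq> F" and len: "length r = length ys"
    and rr: "\<And>i j. i < length ys \<Longrightarrow> j < length ys \<Longrightarrow> r ! i = r ! j \<longleftrightarrow> reach T (ys ! i) (ys ! j)"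
    and "\<And>y. y \<in> Y \<Longrightarrow> \<exists>i<length ys. reach T y (ys ! i)"
    using st by (auto simp: state_def)
  then obtain c where c: "\<And>y. y \<in> Y \<Longrightarrow> c y < length ys" "\<And>y. y \<in> Y \<Longrightarrow> reach T y (ys ! c y)"
    by metis
  obtain q where q: "codes q" and qY: "\<And>y. y \<in> Y \<Longrightarrow> q y = n + r ! c y"
    using codes_exist[of "\<lambda>y. n + r ! c y"] by auto
  have qf: "a < n \<Longrightarrow> q (f a) = a" for a using q by (simp add: codes_def)
  have qys: "q (ys ! i) = n + r ! i" if "i < length ys" for i
  proof -
    have y: "ys ! i \<in> Y" using that ys_Y by auto
    with c rr[OF that, of "c (ys ! i)"] qY show ?thesis by simp
  qed
  have m: "map q ys = map ((+) n) r" using qys len by (intro nth_equalityI) auto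
  have cl: "classifies (verts n) T q"
    unfolding classifies_def
  proof (intro ballI)
    fix u v assume uv: "u \<in> verts n" "v \<in> verts n"
    then consider "u \<in> Y" "v \<in> Y" | a where "a < n" "u = f a" "v \<in> Y" | b where "b < n" "v = f b" "u \<in> Y"
      | a b where "a < n" "u = f a" "b < n" "v = f b"
      by (auto simp: verts_def)
    then show "q u = q v \<longleftrightarrow> reach T u v"
    proof cases
      case 1
      have "q u = q v \<longleftrightarrow> reach T (ys ! c u) (ys ! c v)" using 1 qY c rr by simp
      also have "\<dots> \<longleftrightarrow> reach T u v" using c 1 by (meson reach_sym rtranclp_trans)
      finally show ?thesis .
    next
      case (2 a)
      then have "q u \<noteq> q v" using qf[of a] qY[of v] by simp
      moreover have "\<not> reach T u v" using reach_F[OF _ TF, of u v] f_notin_Y[of a] 2 by auto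
      ultimately show ?thesis by simp
    next
      case (3 b)
      then have "q u \<noteq> q v" using qf[of b] qY[of u] by simp
      moreover have "\<not> reach T u v" using reach_F[OF _ TF, of u v] f_notin_Y[of b] 3 by auto
      ultimately show ?thesis by simp
    next
      case (4 a b)
      have "reach T u v \<longleftrightarrow> u = v" using reach_F[OF _ TF, of u v] f_notin_Y[of a] 4 by auto
      then show ?thesis using 4 qf f_eq_iff by simp
    qed
  qed
  have "q ` Y = set (map ((+) n) r)"
  proof
    show "q ` Y \<subseteq> set (map ((+) n) r)" using qY c len by auto
    show "set (map ((+) n) r) \<subseteq> q ` Y" unfolding m[symmetric] using ys_Y by auto
  qed
  moreover have "q ` f ` {..<n} = {..<n}" using qf by (force simp: image_iff)
  ultimately have "set ([0..<n] @ map ((+) n) r) = q ` verts n"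
    by (simp add: verts_def image_Un Un_commute atLeast0LessThan)
  with that q m cl show thesis by blast
qed

lemma spanning_iff:
  assumes st: "state T C M ls r"
  shows "spanning_ok n ts ies r (ls @ ms) \<longleftrightarrow>
    acyclic_edges (T \<union> edge ` set (sel Tr L (ls @ ms))) \<and>
    connected (verts n) (T \<union> edge ` set (sel Tr L (ls @ ms)))"
proof -
  obtain q where q: "codes q" "map q ys = map ((+) n) r" "classifies (verts n) T q"
    "set ([0..<n] @ map ((+) n) r) = q ` verts n"
    using state_classifier[OF st] .
  let ?S = "sel Tr L (ls @ ms)"
  have T: "T \<subseteq> F" "acyclic_edges T" using st by (auto simp: state_def)
  have S: "set ?S \<subseteq> set L" by (rule set_sel_subset)
  have "tree_check ([0..<n] @ map ((+) n) r) (map (map_prod q q) ?S) \<longleftrightarrow>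
    acyclic_edges (T \<union> edge ` set ?S) \<and> connected (verts n) (T \<union> edge ` set ?S)"
  proof (rule tree_check_iff[OF q(3) T(2) q(4)])
    show "verts n \<noteq> {}" using n_pos by (auto simp: verts_def)
    show "a \<in> verts n \<and> b \<in> verts n \<and> a \<noteq> b" if "(a, b) \<in> set ?S" for a b
      using that S link_verts by blast
    show "distinct (map edge ?S)" by (rule distinct_sel[OF distinct_links])
    show "edge ` set ?S \<inter> T = {}" using S T(1) links_disjoint by blast
  qed
  then show ?thesis
    unfolding spanning_ok_def sel_map[symmetric] map_links[OF q(1)] q(2) .
qed

lemma locally_iff:
  assumes "C \<subseteq> F" "M \<subseteq> F"
  shows "locally_ok n (zip ts (replicate (length ys) n) @ ies) ls \<longleftrightarrow>
    (\<forall>x<n. degree (C \<union> edge ` set (sel Cy L ls)) (f x) \<in> {0, 2} \<and>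
           degree (M \<union> edge ` set (sel Ma L ls)) (f x) \<le> 1)"
proof -
  obtain q where q: "codes q" "map (map_prod q q) L = zip ts (replicate (length ys) n) @ ies"
    by (rule codes_const)
  have "degree (A \<union> edge ` set (sel c L ls)) (f x) =
    occ x (sel c (zip ts (replicate (length ys) n) @ ies) ls)" if "A \<subseteq> F" "x < n" for A x c
    using degree_inner[OF q(1) that(1) set_sel_subset distinct_sel[OF distinct_links] that(2)]
    by (simp add: sel_map[symmetric] q(2))
  then show ?thesis using assms by (auto simp: locally_ok_def Let_def)
qed

text \<open>Used in both directions: from right to left it reads a passing labelling off the smaller
  graph, from left to right it builds a decomposition of the larger one.\<close>

lemma decomposition_iff:
  assumes st: "state T C M ls r" and len: "length ms = length ies"
  shows "locally_ok n (zip ts (replicate (length ys) n) @ ies) (ls @ ms) \<and> spanning_ok n ts ies r (ls @ ms) \<longleftrightarrow>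
    three_decomposition (verts n) (edges ts ies) (T \<union> edge ` set (sel Tr L (ls @ ms)))
      (C \<union> edge ` set (sel Cy L (ls @ ms))) (M \<union> edge ` set (sel Ma L (ls @ ms)))"
proof -
  let ?S = "\<lambda>c. edge ` set (sel c L (ls @ ms))"
  have sub: "T \<subseteq> F" "C \<subseteq> F" "M \<subseteq> F" and dj: "T \<inter> C = {}" "T \<inter> M = {}" "C \<inter> M = {}"
    and un: "T \<union> C \<union> M = F" and lls: "length ls = length ys"
    using st by (auto simp: state_def)
  have S: "?S c \<subseteq> edge ` set L" for c using set_sel_subset by (rule image_mono)
  then have SF: "?S c \<inter> F = {}" for c using links_disjoint by blast
  have cover: "?S Tr \<union> ?S Cy \<union> ?S Ma = edge ` set L"
    unfolding image_Un[symmetric] using len lls length_ts by (subst sel_cover) (simp_all add: links_def)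
  have Sd: "?S c \<inter> ?S d = {}" if "c \<noteq> d" for c d using distinct_links that by (rule sel_disjoint)
  have "edges ts ies = F \<union> (?S Tr \<union> ?S Cy \<union> ?S Ma)" unfolding cover edges_def ..
  also have "\<dots> = (T \<union> ?S Tr) \<union> (C \<union> ?S Cy) \<union> (M \<union> ?S Ma)"
    unfolding un[symmetric] by (simp only: Un_ac)
  finally have E: "(T \<union> ?S Tr) \<union> (C \<union> ?S Cy) \<union> (M \<union> ?S Ma) = edges ts ies" ..
  have "A \<union> ?S c \<subseteq> edges ts ies" if "A \<subseteq> F" for A c
    using that S by (auto simp: edges_def)
  note sub' = this[OF sub(1), of Tr] this[OF sub(2), of Cy] this[OF sub(3), of Ma]
  have dj': "(A \<union> ?S c) \<inter> (B \<union> ?S d) = {}" if "A \<inter> B = {}" "A \<subseteq> F" "B \<subseteq> F" "c \<noteq> d" for A B c d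
  proof -
    have "A \<inter> ?S d = {}" "?S c \<inter> B = {}" using SF[of c] SF[of d] that(2,3) by auto
    then show ?thesis using Sd[OF that(4)] that(1) by (simp add: Int_Un_distrib Int_Un_distrib2)
  qed
  have "(\<forall>y\<in>Y. degree (C \<union> ?S Cy) y \<in> {0, 2}) \<and> (\<forall>y\<in>Y. degree (M \<union> ?S Ma) y \<le> 1)"
    using st degree_outer[OF _ sub(2) lls] degree_outer[OF _ sub(3) lls] by (simp add: state_def)
  then have "locally_ok n (zip ts (replicate (length ys) n) @ ies) (ls @ ms) \<longleftrightarrow>
    (\<forall>v\<in>verts n. degree (C \<union> ?S Cy) v \<in> {0, 2}) \<and> (\<forall>v\<in>verts n. degree (M \<union> ?S Ma) v \<le> 1)"
    unfolding locally_iff[OF sub(2,3)] verts_def by auto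
  then show ?thesis
    unfolding three_decomposition_def spanning_tree_def two_regular_sub_def
      matching_iff_degree[OF graph_edges sub'(3)] spanning_iff[OF st]
    using E sub' dj'[OF dj(1) sub(1,2)] dj'[OF dj(2) sub(1,3)] dj'[OF dj(3) sub(2,3)] by auto
qed

lemma decomposition_state:
  assumes "three_decomposition (verts n) (edges ts ies) T C M"
  obtains ls ms r where "state (T \<inter> F) (C \<inter> F) (M \<inter> F) ls r"
    "\<forall>i<length ys. r ! i \<le> i \<and> r ! (r ! i) = r ! i" "length ms = length ies"
    "locally_ok n (zip ts (replicate (length ys) n) @ ies) (ls @ ms)" "spanning_ok n ts ies r (ls @ ms)"
proof -
  have un: "T \<union> C \<union> M = edges ts ies" and dj: "T \<inter> C = {}" "T \<inter> M = {}" "C \<inter> M = {}"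
    and conn: "connected (verts n) T" and acy: "acyclic_edges T"
    and two: "\<And>v. v \<in> verts n \<Longrightarrow> degree C v \<in> {0, 2}" and mat: "matching (edges ts ies) M"
    using assms by (auto simp: three_decomposition_def spanning_tree_def two_regular_sub_def)
  define lab where "lab p = (if edge p \<in> T then Tr else if edge p \<in> C then Cy else Ma)" for p
  define ls where "ls = map lab (zip (map f ts) ys)"
  define ms where "ms = map lab (map (map_prod f f) ies)"
  have lsms: "ls @ ms = map lab L" by (simp add: ls_def ms_def links_def)
  have lens: "length ls = length ys" "length ms = length ies"
    using length_ts by (simp_all add: ls_def ms_def)
  have D: "D = (D \<inter> F) \<union> edge ` set (sel c L (ls @ ms))"
    if "D \<subseteq> edges ts ies" "\<And>p. p \<in> set L \<Longrightarrow> edge p \<in> D \<longleftrightarrow> lab p = c" for D c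
  proof -
    have "edge ` set (sel c L (ls @ ms)) = D \<inter> edge ` set L"
      unfolding lsms sel_labelling using that(2) by auto
    with that(1) show ?thesis by (auto simp: edges_def)
  qed
  have inE: "edge p \<in> edges ts ies" if "p \<in> set L" for p using that by (simp add: edges_def)
  have T: "T = (T \<inter> F) \<union> edge ` set (sel Tr L (ls @ ms))"
    by (rule D) (use un in \<open>auto simp: lab_def\<close>)
  have C: "C = (C \<inter> F) \<union> edge ` set (sel Cy L (ls @ ms))"
    by (rule D) (use un dj in \<open>auto simp: lab_def\<close>)
  have M: "M = (M \<inter> F) \<union> edge ` set (sel Ma L (ls @ ms))"
    by (rule D) (use un dj inE in \<open>auto simp: lab_def\<close>)
  define R where "R i j \<longleftrightarrow> j < length ys \<and> reach (T \<inter> F) (ys ! i) (ys ! j)" for i j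
  \<comment> \<open>The least index in each class makes the partition canonical, hence an entry of
    the enumerated list.\<close>
  define r where "r = map (\<lambda>i. LEAST j. R i j) [0..<length ys]"
  have r: "r ! i = (LEAST j. R i j)" if "i < length ys" for i using that by (simp add: r_def)
  have Rii: "R i i" if "i < length ys" for i using that by (simp add: R_def)
  have Rr: "R i (r ! i)" if "i < length ys" for i unfolding r[OF that] using Rii[OF that] by (rule LeastI)
  have Req: "R i = R j" if "i < length ys" "j < length ys" "reach (T \<inter> F) (ys ! i) (ys ! j)" for i j
    using that unfolding R_def by (intro ext) (meson reach_sym rtranclp_trans)
  have rle: "r ! i \<le> i" if "i < length ys" for i unfolding r[OF that] using Rii[OF that] by (rule Least_le)
  have rr: "r ! i = r ! j \<longleftrightarrow> reach (T \<inter> F) (ys ! i) (ys ! j)" if "i < length ys" "j < length ys" for i j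
  proof
    assume "r ! i = r ! j"
    then show "reach (T \<inter> F) (ys ! i) (ys ! j)"
      using Rr[OF that(1)] Rr[OF that(2)] unfolding R_def by (metis reach_sym rtranclp_trans)
  next
    assume "reach (T \<inter> F) (ys ! i) (ys ! j)"
    then show "r ! i = r ! j" using r that Req by metis
  qed
  have canon: "\<forall>i<length ys. r ! i \<le> i \<and> r ! (r ! i) = r ! i"
    using rle rr Rr unfolding R_def by (metis reach_sym)
  \<comment> \<open>On the tree path from y to the pole, the first edge outside \<open>F\<close> is
    a dangling one, and it starts at an outer end.\<close>
  have reaches: "\<exists>i<length ys. reach (T \<inter> F) y (ys ! i)" if "y \<in> Y" for y
  proof -
    have f0: "f 0 \<in> verts n" "f 0 \<notin> Y" using n_pos f_notin_Y by (auto simp: verts_def)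
    have "reach T y (f 0)" using conn that f0 by (simp add: connected_def verts_def)
    then have "y \<in> Y \<longrightarrow> (\<exists>i<length ys. reach (T \<inter> F) y (ys ! i))"
    proof (induction rule: converse_rtranclp_induct)
      case base
      with f0 show ?case by simp
    next
      case (step y z)
      show ?case
      proof
        assume y: "y \<in> Y"
        have yz: "{y, z} \<in> T" using step(1) by (simp add: adj_def)
        then have "{y, z} \<in> edges ts ies" using un by blast
        then consider "{y, z} \<in> F" | p where "p \<in> set L" "edge p = {y, z}" by (auto simp: edges_def)
        then show "\<exists>i<length ys. reach (T \<inter> F) y (ys ! i)"
        proof cases
          case 1
          then have "z \<in> Y" "adj (T \<inter> F) y z" using F_subset yz by (auto simp: adj_def)
          with step.IH show ?thesis by (meson converse_rtranclp_into_rtranclp)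
        next
          case (2 p)
          from 2(1) show ?thesis
          proof (cases rule: link_cases)
            case (1 t y')
            with 2(2) y f_notin_Y have "y = y'" by (auto simp: doubleton_eq_iff)
            moreover have "y' \<in> set ys" using 1(4) by (auto dest: set_zip_rightD)
            ultimately show ?thesis by (auto simp: in_set_conv_nth)
          next
            case (2 a b)
            with \<open>edge p = {y, z}\<close> y f_notin_Y show ?thesis by (auto simp: doubleton_eq_iff)
          qed
        qed
      qed
    qed
    with that show ?thesis by blast
  qed
  have vY: "y \<in> verts n" if "y \<in> Y" for y using that by (simp add: verts_def)
  have degC: "degree (C \<inter> F) y + count_list (zip ys ls) (y, Cy) \<in> {0, 2}" if "y \<in> Y" for y
    using degree_outer[OF that Int_lower2 lens(1), of C Cy ms] C two[OF vY[OF that]] by simp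
  have M1: "degree M y \<le> 1" if "y \<in> verts n" for y
    using mat matching_iff_degree[OF graph_edges, of M] un that by blast
  have degM: "degree (M \<inter> F) y + count_list (zip ys ls) (y, Ma) \<le> 1" if "y \<in> Y" for y
    using degree_outer[OF that Int_lower2 lens(1), of M Ma ms] M M1[OF vY[OF that]] by simp
  have "(T \<inter> F) \<union> (C \<inter> F) \<union> (M \<inter> F) = (T \<union> C \<union> M) \<inter> F" by (simp add: Int_Un_distrib2)
  also have "\<dots> = F" unfolding un edges_def by blast
  finally have unF: "(T \<inter> F) \<union> (C \<inter> F) \<union> (M \<inter> F) = F" .
  have djF: "(T \<inter> F) \<inter> (C \<inter> F) = {}" "(T \<inter> F) \<inter> (M \<inter> F) = {}" "(C \<inter> F) \<inter> (M \<inter> F) = {}"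
    using dj by auto
  have "acyclic_edges (T \<inter> F)" using acy by (rule acyclic_subset) auto
  with lens(1) rr reaches degC degM unF djF have st: "state (T \<inter> F) (C \<inter> F) (M \<inter> F) ls r"
    unfolding state_def r_def[THEN arg_cong[where f = length]] length_map length_upt diff_zero by blast
  have "locally_ok n (zip ts (replicate (length ys) n) @ ies) (ls @ ms) \<and> spanning_ok n ts ies r (ls @ ms)"
    unfolding decomposition_iff[OF st lens(2)] using assms T C M by simp
  with that[OF st canon lens(2)] show thesis by blast
qed

end

text \<open>Partitions of \<^term>\<open>{..<k}\<close>, each element being mapped to the least element of its block.\<close>

fun canonical :: "nat \<Rightarrow> nat list list" where
  "canonical 0 = [[]]"
| "canonical (Suc k) =
    concat (map (\<lambda>r. map (\<lambda>x. r @ [x]) (filter (\<lambda>x. x = k \<or> r ! x = x) [0..<Suc k])) (canonical k))"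

lemma canonical_complete:
  assumes "length r = k" "\<forall>i<k. r ! i \<le> i \<and> r ! (r ! i) = r ! i"
  shows "r \<in> set (canonical k)"
  using assms
proof (induction k arbitrary: r)
  case (Suc k)
  then obtain s x where r: "r = s @ [x]" "length s = k" by (metis length_Suc_conv_rev)
  have "s ! i \<le> i \<and> s ! (s ! i) = s ! i" if "i < k" for i
    using Suc.prems(2) that r by (auto simp: nth_append dest!: spec[of _ i])
  then have "s \<in> set (canonical k)" using Suc.IH r by blast
  moreover have "x \<le> k" "x = k \<or> s ! x = x"
    using Suc.prems(2)[rule_format, of k] r by (auto simp: nth_append split: if_splits)
  ultimately show ?case using r by (auto intro!: bexI[of _ s])
qed simp

text \<open>A candidate in \<^term>\<open>W\<close> labels first the dangling and then the inner edges. The nested conditionals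
  keep the evaluation by rewriting lazy.\<close>

definition reduces :: "nat \<Rightarrow> nat \<Rightarrow> nat list \<Rightarrow> (nat \<times> nat) list \<Rightarrow> nat \<Rightarrow> nat list \<Rightarrow> (nat \<times> nat) list \<Rightarrow>
    nat list list \<Rightarrow> label list list \<Rightarrow> bool" where
  "reduces k m ts ies n us jes R W \<longleftrightarrow>
    (\<forall>w\<in>set W. length w = k + length jes \<and> locally_ok n (zip us (replicate k n) @ jes) w) \<and>
    (\<forall>ls\<in>set (List.n_lists k [Tr, Cy, Ma]). \<forall>ms\<in>set (List.n_lists (length ies) [Tr, Cy, Ma]).
      if locally_ok m (zip ts (replicate k m) @ ies) (ls @ ms)
      then \<forall>r\<in>set R. if spanning_ok m ts ies r (ls @ ms)
        then \<exists>w\<in>set W. if upgrade ls (take k w) then spanning_ok n us jes r w else False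
        else True
      else True)"

lemma (in attached) decomposition_of_state:
  assumes "state T C M ls r" "upgrade ls (take (length ys) w)" "length w = length ys + length ies"
    and "locally_ok n (zip ts (replicate (length ys) n) @ ies) w" "spanning_ok n ts ies r w"
  shows "has_3_decomposition (verts n) (edges ts ies)"
proof -
  have "state T C M (take (length ys) w) r" using assms(1,2) by (rule state_upgrade)
  from decomposition_iff[OF this, of "drop (length ys) w"] assms(3-5) show ?thesis
    by (auto simp: has_3_decomposition_def)
qed

text \<open>The decomposition of the smaller graph yields a state, and the table provides labels for
  the larger pole that fit this state. \<open>R\<close> may leave out partitions that no state of
  the given outside can have; the domino relies on this.\<close>

lemma (in outside) reduction:
  assumes K: "attached Y F ys f N m ts ies" and X: "attached Y F ys f N n us jes"
    and red: "reduces (length ys) m ts ies n us jes R W"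
    and R: "\<And>T C M ls r. state T C M ls r \<Longrightarrow> r \<in> set (canonical (length ys)) \<Longrightarrow> r \<in> set R"
    and dec: "has_3_decomposition (verts m) (edges ts ies)"
  shows "has_3_decomposition (verts n) (edges us jes)"
proof -
  interpret K: attached Y F ys f N m ts ies by fact
  interpret X: attached Y F ys f N n us jes by fact
  obtain T C M where "three_decomposition (verts m) (edges ts ies) T C M"
    using dec by (auto simp: has_3_decomposition_def)
  then obtain ls ms r where st: "state (T \<inter> F) (C \<inter> F) (M \<inter> F) ls r"
    and r: "\<forall>i<length ys. r ! i \<le> i \<and> r ! (r ! i) = r ! i" and ms: "length ms = length ies"
    and ok: "locally_ok m (zip ts (replicate (length ys) m) @ ies) (ls @ ms)" "spanning_ok m ts ies r (ls @ ms)"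
    by (rule K.decomposition_state)
  have lens: "length ls = length ys" "length r = length ys" using st by (auto simp: state_def)
  have "r \<in> set R" using R[OF st] canonical_complete[OF lens(2) r] by blast
  moreover have "xs \<in> set (List.n_lists (length xs) [Tr, Cy, Ma])" for xs
    unfolding set_n_lists using label.exhaust by auto
  ultimately obtain w where "w \<in> set W" "upgrade ls (take (length ys) w)" "spanning_ok n us jes r w"
    using red ok lens(1) ms unfolding reduces_def by (metis (no_types, lifting))
  moreover from this red have "length w = length ys + length jes"
    "locally_ok n (zip us (replicate (length ys) n) @ jes) w" by (auto simp: reduces_def)
  ultimately show ?thesis using X.decomposition_of_state[OF st] by blast
qed

section \<open>Transport and occurrences\<close>

lemma graph_edges_Pow: "graph V E \<Longrightarrow> E \<subseteq> Pow V"
  by (auto simp: graph_def)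

lemma graph_edge_other:
  assumes "graph V E" "e \<in> E" "v \<in> e"
  obtains w where "e = {v, w}"
proof -
  obtain x y where e: "e = {x, y}" using assms(1,2) unfolding graph_def by meson
  with assms(3) have "v = x \<or> v = y" by auto
  then show thesis using that[of x] that[of y] e by (auto simp: insert_commute)
qed

lemma inj_on_image_Pow: "inj_on h V \<Longrightarrow> A \<subseteq> Pow V \<Longrightarrow> inj_on ((`) h) A"
  by (rule inj_onI) (meson PowD inj_on_image_eq_iff subsetD)

lemma degree_image:
  assumes "inj_on h V" "A \<subseteq> Pow V" "v \<in> V"
  shows "degree ((`) h ` A) (h v) = degree A v"
proof -
  have "h v \<in> h ` e \<longleftrightarrow> v \<in> e" if "e \<in> A" for e
    using assms that by (intro inj_on_image_mem_iff[of h V]) auto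
  then have "{e \<in> (`) h ` A. h v \<in> e} = (`) h ` {e \<in> A. v \<in> e}" by auto
  moreover have "inj_on ((`) h) {e \<in> A. v \<in> e}"
    using assms by (intro inj_on_image_Pow[of h V]) auto
  ultimately show ?thesis by (simp add: degree_def card_image)
qed

lemma graph_image: "graph V E \<Longrightarrow> inj_on h V \<Longrightarrow> graph (h ` V) ((`) h ` E)"
proof -
  assume g: "graph V E" and i: "inj_on h V"
  have "\<exists>u v. u \<noteq> v \<and> u \<in> h ` V \<and> v \<in> h ` V \<and> h ` e = {u, v}" if "e \<in> E" for e
  proof -
    obtain x y where "x \<noteq> y" "x \<in> V" "y \<in> V" "e = {x, y}" using g \<open>e \<in> E\<close> unfolding graph_def by meson
    then show ?thesis using i by (intro exI[of _ "h x"] exI[of _ "h y"]) (auto dest: inj_onD)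
  qed
  then show ?thesis using g by (auto simp: graph_def)
qed

lemma three_edge_connected_image:
  assumes g: "graph V E" and i: "inj_on h V" and t: "three_edge_connected V E"
  shows "three_edge_connected (h ` V) ((`) h ` E)"
  unfolding three_edge_connected_def
proof (intro allI impI)
  fix S assume S: "S \<subset> h ` V" "S \<noteq> {}"
  define R where "R = {v \<in> V. h v \<in> S}"
  have SR: "S = h ` R" using S(1) by (auto simp: R_def)
  have "R \<subseteq> V" by (auto simp: R_def)
  moreover have "R \<noteq> V" using S(1) SR by blast
  ultimately have R: "R \<subset> V" "R \<noteq> {}" using S(2) SR by auto
  have "h ` e \<inter> S \<noteq> {} \<longleftrightarrow> e \<inter> R \<noteq> {}" "h ` e \<subseteq> S \<longleftrightarrow> e \<subseteq> R" if "e \<in> E" for e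
    using graph_edges_Pow[OF g] that by (auto simp: R_def)
  then have "boundary ((`) h ` E) S = (`) h ` boundary E R" by (auto simp: boundary_def)
  moreover have "inj_on ((`) h) (boundary E R)"
    using graph_edges_Pow[OF g] by (intro inj_on_image_Pow[OF i]) (auto simp: boundary_def)
  ultimately have "card (boundary ((`) h ` E) S) = card (boundary E R)" by (simp add: card_image)
  with t R show "3 \<le> card (boundary ((`) h ` E) S)" by (simp add: three_edge_connected_def)
qed

lemma reach_image: "reach T u v \<Longrightarrow> reach ((`) h ` T) (h u) (h v)"
proof (induction rule: rtranclp_induct)
  case (step v w)
  then have "{v, w} \<in> T" by (simp add: adj_def)
  then have "h ` {v, w} \<in> (`) h ` T" by (rule imageI)
  then have "adj ((`) h ` T) (h v) (h w)" by (simp add: adj_def)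
  with step.IH show ?case by (rule rtranclp.rtrancl_into_rtrancl)
qed simp

lemma three_decomposition_image:
  assumes g: "graph V E" and i: "inj_on h V" and d: "three_decomposition V E T C M"
  shows "three_decomposition (h ` V) ((`) h ` E) ((`) h ` T) ((`) h ` C) ((`) h ` M)"
proof -
  let ?h = "(`) h"
  have un: "T \<union> C \<union> M = E" and dj: "T \<inter> C = {}" "T \<inter> M = {}" "C \<inter> M = {}"
    and conn: "connected V T" and acy: "acyclic_edges T"
    and two: "\<And>v. v \<in> V \<Longrightarrow> degree C v = 0 \<or> degree C v = 2" and mat: "matching E M"
    using d by (auto simp: three_decomposition_def spanning_tree_def two_regular_sub_def)
  have EP: "E \<subseteq> Pow V" using g by (rule graph_edges_Pow)
  have iE: "inj_on ?h E" using i EP by (rule inj_on_image_Pow)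
  have sub: "T \<subseteq> E" "C \<subseteq> E" "M \<subseteq> E" using un by auto
  have disj: "?h ` A \<inter> ?h ` B = {}" if "A \<inter> B = {}" "A \<subseteq> E" "B \<subseteq> E" for A B
    using inj_on_image_Int[OF iE that(2,3)] that(1) by simp
  have "acyclic_edges (?h ` T)"
    unfolding acyclic_edges_def
  proof
    assume "\<exists>vs. is_cycle (?h ` T) vs"
    then obtain vs where len: "length vs \<ge> 3" and dis: "distinct vs"
      and c: "\<And>k. k < length vs \<Longrightarrow> {vs ! k, vs ! ((k + 1) mod length vs)} \<in> ?h ` T"
      by (auto simp: is_cycle_def)
    let ?g = "inv_into V h"
    have hV: "vs ! k \<in> h ` V" if "k < length vs" for k
      using c[OF that] sub(1) EP by blast
    then have "set vs \<subseteq> h ` V" by (auto simp: in_set_conv_nth)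
    then have "distinct (map ?g vs)" using dis inj_on_inv_into by (auto simp: distinct_map)
    moreover have "{?g (vs ! k), ?g (vs ! ((k + 1) mod length vs))} \<in> T" if "k < length vs" for k
    proof -
      from c[OF that] obtain e where e: "e \<in> T" "{vs ! k, vs ! ((k + 1) mod length vs)} = h ` e" by blast
      have "?g ` h ` e = e" using i e(1) sub(1) EP by (intro inv_into_image_cancel) auto
      with e show ?thesis by (metis image_insert image_empty)
    qed
    moreover have "(k + 1) mod length vs < length vs" for k using len by (intro mod_less_divisor) linarith
    ultimately have "is_cycle T (map ?g vs)" using len by (simp add: is_cycle_def)
    with acy show False by (auto simp: acyclic_edges_def)
  qed
  moreover have "connected (h ` V) (?h ` T)"
    using conn reach_image[of T _ _ h] unfolding connected_def by simp
  moreover have "two_regular_sub (h ` V) (?h ` E) (?h ` C)"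
    using two sub(2) EP degree_image[OF i, of C] by (auto simp: two_regular_sub_def)
  moreover have "matching (?h ` E) (?h ` M)"
  proof -
    have "\<forall>v\<in>V. degree M v \<le> 1" using mat matching_iff_degree[OF g sub(3)] by simp
    then have "\<forall>v\<in>h ` V. degree (?h ` M) v \<le> 1" using sub(3) EP degree_image[OF i, of M] by auto
    then show ?thesis using matching_iff_degree[OF graph_image[OF g i] image_mono[OF sub(3)]] by simp
  qed
  moreover have "?h ` T \<union> ?h ` C \<union> ?h ` M = ?h ` E" by (simp add: un[symmetric] image_Un)
  ultimately show ?thesis
    using disj[OF dj(1) sub(1,2)] disj[OF dj(2) sub(1,3)] disj[OF dj(3) sub(2,3)] sub(1)
    by (auto simp: three_decomposition_def spanning_tree_def)
qed

text \<open>Minimality is assumed for graphs on the naturals, whereas replacements keep the vertex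
  type of the given graph. A finite graph is moved to the naturals by an injection, and the
  decomposition found there is moved back by the inverse.\<close>

lemma smaller_has_decomposition:
  fixes V :: "'a set" and E :: "'a set set"
  assumes minimal: "\<forall>(V' :: nat set) E'. graph V' E' \<and> cubic V' E' \<and> k_connected 3 V' E' \<and>
            \<not> has_3_decomposition V' E' \<longrightarrow> N \<le> card V'"
    and g: "graph V E" and c: "cubic V E" and t: "three_edge_connected V E"
    and card: "3 < card V" "card V < N"
  shows "has_3_decomposition V E"
proof -
  have "finite V" using g by (simp add: graph_def)
  then obtain h :: "'a \<Rightarrow> nat" where i: "inj_on h V"
    using finite_imp_inj_to_nat_seg by blast
  let ?V = "h ` V" and ?E = "(`) h ` E"
  have g': "graph ?V ?E" using g i by (rule graph_image)
  have cV: "card ?V = card V" using i by (rule card_image)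
  have c': "cubic ?V ?E"
    using c degree_image[OF i graph_edges_Pow[OF g]] by (auto simp: cubic_def)
  have "k_connected 3 ?V ?E"
    using three_edge_connected_imp_k_connected[OF g' c' three_edge_connected_image[OF g i t]] card(1) cV by simp
  with minimal g' c' cV card(2) have "has_3_decomposition ?V ?E" by (metis not_le)
  then obtain T C M where d: "three_decomposition ?V ?E T C M" by (auto simp: has_3_decomposition_def)
  let ?g = "inv_into V h"
  have "inj_on ?g ?V" by (rule inj_on_inv_into) simp
  from three_decomposition_image[OF g' this d]
  have "has_3_decomposition (?g ` ?V) ((`) ?g ` ?E)" unfolding has_3_decomposition_def by blast
  moreover have "?g ` ?V = V" using i by simp
  moreover have "(`) ?g ` ?E = E"
  proof -
    have "?g ` h ` e = e" if "e \<in> E" for e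
      using i graph_edges_Pow[OF g] that by (intro inv_into_image_cancel) auto
    then show ?thesis by (force simp: image_iff)
  qed
  ultimately show ?thesis by simp
qed

section \<open>Copies of a configuration in the whole graph\<close>

locale occurrence =
  fixes V :: "'a set" and E :: "'a set set" and f :: "nat \<Rightarrow> 'a"
    and k n :: nat and ts :: "nat list" and ies :: "(nat \<times> nat) list"
  assumes graph: "graph V E" and cubic: "cubic V E" and cuts: "three_edge_connected V E"
    and pole: "pole k n ts ies" and distinct_ts: "distinct ts"
    and inj: "inj_on f {..<n}" and f_V: "f ` {..<n} \<subseteq> V"
    and inner_edge: "\<And>a b. (a, b) \<in> set ies \<Longrightarrow> {f a, f b} \<in> E"
begin

text \<open>Only neighbours along edges of the configuration count; the graph may have further edges
  between vertices of the copy.\<close>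

definition inner :: "nat \<Rightarrow> 'a \<Rightarrow> bool" where
  "inner a v \<longleftrightarrow> (\<exists>b<n. v = f b \<and> {a, b} \<in> edge ` set ies)"

lemma ies_n: "(a, b) \<in> set ies \<Longrightarrow> a < n \<and> b < n \<and> a \<noteq> b"
  using pole by (auto simp: pole_def)

lemma f_eq_iff: "a < n \<Longrightarrow> b < n \<Longrightarrow> f a = f b \<longleftrightarrow> a = b"
  using inj by (auto simp: inj_on_def)

lemma incident_inner:
  assumes "a < n"
  shows "{e \<in> edge ` set (map (map_prod f f) ies). f a \<in> e} = {{f a, v} | v. inner a v}"
proof (intro equalityI subsetI)
  fix e assume "e \<in> {e \<in> edge ` set (map (map_prod f f) ies). f a \<in> e}"
  then obtain x y where xy: "(x, y) \<in> set ies" "e = {f x, f y}" "f a \<in> e" by force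
  then have "x < n" "y < n" using ies_n by auto
  then consider "a = x" | "a = y" using xy f_eq_iff[OF assms] by auto
  then show "e \<in> {{f a, v} | v. inner a v}"
  proof cases
    case 1
    then have "inner a (f y)" using xy(1) \<open>y < n\<close> by (force simp: inner_def)
    with 1 xy show ?thesis by auto
  next
    case 2
    then have "inner a (f x)" using xy(1) \<open>x < n\<close> by (force simp: inner_def insert_commute)
    with 2 xy show ?thesis by (auto simp: insert_commute)
  qed
next
  fix e assume "e \<in> {{f a, v} | v. inner a v}"
  then obtain b p where b: "e = {f a, f b}" "p \<in> set ies" "edge p = {a, b}" by (auto simp: inner_def)
  obtain x y where p: "p = (x, y)" by (cases p)
  with b have "e = edge (map_prod f f p)" by (auto simp: doubleton_eq_iff)
  with b show "e \<in> {e \<in> edge ` set (map (map_prod f f) ies). f a \<in> e}" by auto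
qed

text \<open>In a pole every node has degree three, and as \<open>ts\<close> is distinct a terminal
  spends exactly one of its three edges on the outside.\<close>

lemma card_incident_inner:
  assumes "a < n"
  shows "card {{f a, v} | v. inner a v} = (if a \<in> set ts then 2 else 3)"
proof -
  have "distinct (map edge (map (map_prod f f) ies))"
    using inj ies_n pole by (intro distinct_map_edges[of f "{..<n}"]) (auto simp: pole_def)
  then have "card {e \<in> {} \<union> edge ` set (map (map_prod f f) ies). f a \<in> e} =
    card {e \<in> {}. f a \<in> e} + length (filter (\<lambda>p. f a \<in> edge p) (map (map_prod f f) ies))"
    by (intro card_filter_edges) auto
  also have "filter (\<lambda>p. f a \<in> edge p) (map (map_prod f f) ies) =
    map (map_prod f f) (filter (\<lambda>(x, y). a = x \<or> a = y) ies)"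
  proof -
    have "f a \<in> edge (map_prod f f p) \<longleftrightarrow> (case p of (x, y) \<Rightarrow> a = x \<or> a = y)" if "p \<in> set ies" for p
    proof -
      obtain x y where p: "p = (x, y)" by (cases p)
      then have "x < n" "y < n" using that ies_n by auto
      with p show ?thesis using f_eq_iff[OF assms] by simp
    qed
    then show ?thesis unfolding filter_map comp_def by (intro arg_cong[where f = "map _"] filter_cong) auto
  qed
  finally have "card {e \<in> edge ` set (map (map_prod f f) ies). f a \<in> e} = occ a ies"
    by (simp add: occ_def)
  moreover have "occ a (zip ts (replicate k n) @ ies) = (if a \<in> set ts then 1 else 0) + occ a ies"
  proof -
    have 1: "length (filter (\<lambda>(x, y). a = x \<or> a = y) (zip us (replicate (length us) n))) = count_list us a" for us
      using assms by (induction us) auto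
    have 2: "length ts = k" using pole by (simp add: pole_def)
    have 3: "count_list us a = (if a \<in> set us then 1 else 0)" if "distinct us" for us
      using that by (induction us) auto
    show ?thesis unfolding occ_def filter_append length_append 2[symmetric] 1 3[OF distinct_ts] ..
  qed
  moreover have "occ a (zip ts (replicate k n) @ ies) = 3" using pole assms by (auto simp: pole_def)
  ultimately show ?thesis unfolding incident_inner[OF assms] by (simp split: if_splits)
qed

lemma inner_in_E: "a < n \<Longrightarrow> inner a v \<Longrightarrow> {f a, v} \<in> E"
proof -
  assume "a < n" "inner a v"
  then have "{f a, v} \<in> edge ` set (map (map_prod f f) ies)" using incident_inner by blast
  then show ?thesis using inner_edge by force
qed

lemma card_incident: "a < n \<Longrightarrow> card {e \<in> E. f a \<in> e} = 3"
  using cubic f_V by (auto simp: cubic_def degree_def)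

lemma finite_incident: "finite {e \<in> E. v \<in> e}"
  using graph_finite_edges[OF graph] by simp

lemma neighbour_of_full:
  assumes "a < n" "a \<notin> set ts" "{f a, v} \<in> E"
  shows "inner a v"
proof -
  have "{{f a, v} | v. inner a v} = {e \<in> E. f a \<in> e}"
    using inner_in_E[OF assms(1)] card_incident_inner[OF assms(1)] card_incident[OF assms(1)] assms(2)
    by (intro card_subset_eq finite_incident) auto
  with assms(3) obtain w where "{f a, v} = {f a, w}" "inner a w" by blast
  then show ?thesis by (auto simp: doubleton_eq_iff)
qed

lemma outer_neighbour:
  assumes "t < n" "t \<in> set ts"
  shows "\<exists>w. {f t, w} \<in> E \<and> \<not> inner t w \<and> (\<forall>v. {f t, v} \<in> E \<longrightarrow> v = w \<or> inner t v)"
proof -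
  let ?I = "{{f t, v} | v. inner t v}" and ?J = "{e \<in> E. f t \<in> e}"
  have IJ: "?I \<subseteq> ?J" using inner_in_E[OF assms(1)] by auto
  then have "card (?J - ?I) = 1"
    using card_incident_inner[OF assms(1)] card_incident[OF assms(1)] assms(2)
    by (subst card_Diff_subset) (auto intro: finite_subset[OF _ finite_incident])
  then obtain e where e: "?J - ?I = {e}" by (auto simp: card_1_singleton_iff)
  then have eE: "e \<in> E" "f t \<in> e" and eI: "e \<notin> ?I" by auto
  obtain w where w: "e = {f t, w}" by (rule graph_edge_other[OF graph eE])
  have "v = w \<or> inner t v" if "{f t, v} \<in> E" for v
  proof (cases "{f t, v} \<in> ?I")
    case True
    then obtain u where "{f t, v} = {f t, u}" "inner t u" by blast
    then show ?thesis by (auto simp: doubleton_eq_iff)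
  next
    case False
    then have "{f t, v} \<in> ?J - ?I" using that by (simp del: mem_Collect_eq add: mem_Collect_eq[of "{f t, v}" "\<lambda>e. e \<in> E \<and> f t \<in> e"])
    then have "{f t, v} = e" unfolding e by (rule singletonD)
    with w show ?thesis by (auto simp: doubleton_eq_iff)
  qed
  moreover have "\<not> inner t w" using eI w by blast
  ultimately show ?thesis using eE(1) w by blast
qed

lemma inner_iff: "a < n \<Longrightarrow> b < n \<Longrightarrow> inner a (f b) \<longleftrightarrow> {a, b} \<in> edge ` set ies"
  using f_eq_iff[of b] by (auto simp: inner_def)

lemma inner_sym: "a < n \<Longrightarrow> b < n \<Longrightarrow> inner a (f b) \<longleftrightarrow> inner b (f a)"
  by (simp add: inner_iff insert_commute)

lemma ts_n: "t \<in> set ts \<Longrightarrow> t < n"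
  using pole by (simp add: pole_def)

lemma no_loop: "{v, v} \<notin> E"
  using graph unfolding graph_def by fastforce

definition outer :: "nat \<Rightarrow> 'a" where
  "outer t = (SOME w. {f t, w} \<in> E \<and> \<not> inner t w \<and> (\<forall>v. {f t, v} \<in> E \<longrightarrow> v = w \<or> inner t v))"

lemma outer:
  assumes "t \<in> set ts"
  shows "{f t, outer t} \<in> E" "\<not> inner t (outer t)" "{f t, v} \<in> E \<Longrightarrow> v = outer t \<or> inner t v"
  using someI_ex[OF outer_neighbour[OF ts_n[OF assms] assms]] unfolding outer_def by blast+

text \<open>A node with three configuration edges has none left to receive the free edge of a
  terminal.\<close>

lemma outer_terminal:
  assumes "s \<in> set ts" "b < n" "outer s = f b"
  shows "b \<in> set ts" "b \<noteq> s" "{s, b} \<notin> edge ` set ies"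
proof -
  have e: "{f s, f b} \<in> E" "\<not> inner s (f b)" using outer(1,2)[OF assms(1)] assms(3) by auto
  show "b \<noteq> s" using e(1) no_loop by auto
  show "b \<in> set ts"
    using e neighbour_of_full[OF assms(2), of "f s"] inner_sym[OF ts_n[OF assms(1)] assms(2)]
    by (auto simp: insert_commute)
  show "{s, b} \<notin> edge ` set ies" using e(2) inner_iff[OF ts_n[OF assms(1)] assms(2)] by simp
qed

text \<open>Without extra edges between terminals, each free edge ends outside the copy. The graph
  then consists of the copy, the graph induced on the other vertices, and one dangling edge for each
  terminal.\<close>

lemma attached_occurrence:
  assumes no_extra: "\<And>t t'. t \<in> set ts \<Longrightarrow> t' \<in> set ts \<Longrightarrow> t \<noteq> t' \<Longrightarrow> {f t, f t'} \<in> E \<Longrightarrow> {t, t'} \<in> edge ` set ies"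
  obtains Y F ys where "attached Y F ys f n n ts ies" "V = outside.verts Y f n"
    "E = outside.edges F ys f ts ies" "length ys = k"
proof -
  define Y where "Y = V - f ` {..<n}"
  define F where "F = {e \<in> E. e \<subseteq> Y}"
  define ys where "ys = map outer ts"
  have EV: "u \<in> V \<and> v \<in> V" if "{u, v} \<in> E" for u v using graph_edges_Pow[OF graph] that by auto
  have oY: "outer t \<in> Y" if t: "t \<in> set ts" for t
  proof -
    have "outer t \<noteq> f b" if "b < n" for b
      using outer_terminal[OF t that] no_extra[OF t, of b] outer(1)[OF t] by metis
    with EV[OF outer(1)[OF t]] show ?thesis by (auto simp: Y_def)
  qed
  have k: "length ts = k" using pole by (simp add: pole_def)
  have "graph Y F"
    unfolding graph_def
  proof (intro conjI ballI)
    show "finite Y" using graph by (simp add: graph_def Y_def)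
    fix e assume e: "e \<in> F"
    then obtain u v where "u \<noteq> v" "e = {u, v}" using graph unfolding graph_def F_def by (metis (no_types, lifting) mem_Collect_eq)
    with e show "\<exists>u v. u \<noteq> v \<and> u \<in> Y \<and> v \<in> Y \<and> e = {u, v}" by (auto simp: F_def)
  qed
  moreover have "distinct (zip ts ys)" using distinct_ts by (rule distinct_zipI1)
  ultimately have at: "attached Y F ys f n n ts ies"
    using pole inj oY k by unfold_locales (auto simp: ys_def Y_def)
  interpret attached Y F ys f n n ts ies by (rule at)
  have "E = edges ts ies"
  proof (intro equalityI subsetI)
    fix e assume eE: "e \<in> E"
    show "e \<in> edges ts ies"
    proof (cases "e \<subseteq> Y")
      case True
      with eE have "e \<in> F" by (simp add: F_def)
      then show ?thesis by (simp add: edges_def)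
    next
      case False
      then obtain a where an: "a < n" "f a \<in> e"
        using graph_edges_Pow[OF graph] eE by (auto simp: Y_def)
      then obtain w where a: "a < n" "e = {f a, w}" using graph_edge_other[OF graph eE] by metis
      show ?thesis
      proof (cases "inner a w")
        case True
        then have "e \<in> edge ` set (map (map_prod f f) ies)"
          using incident_inner[OF a(1)] a(2) by blast
        then show ?thesis by (auto simp: edges_def links_def)
      next
        case False
        then have t: "a \<in> set ts" using neighbour_of_full[OF a(1)] eE a(2) by blast
        with False have w: "w = outer a" using outer(3) eE a(2) by blast
        have "zip (map f ts) ys = map (\<lambda>t. (f t, outer t)) ts" by (simp add: ys_def zip_map_map zip_same_conv_map)
        with t have "(f a, outer a) \<in> set (zip (map f ts) ys)" by auto
        then show ?thesis using a(2) w by (force simp: edges_def links_def)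
      qed
    qed
  next
    fix e assume "e \<in> edges ts ies"
    then consider "e \<in> F" | p where "p \<in> set (zip (map f ts) ys)" "e = edge p"
      | a b where "(a, b) \<in> set ies" "e = {f a, f b}" by (auto simp: edges_def links_def)
    then show "e \<in> E"
    proof cases
      case (2 p)
      then show ?thesis using outer(1) by (auto simp: ys_def set_zip)
    qed (auto simp: F_def inner_edge)
  qed
  moreover have "V = verts n" unfolding verts_def using f_V by (auto simp: Y_def)
  ultimately show thesis using that[OF at] k by (simp add: ys_def)
qed

text \<open>An extra edge tt' uses up the free edges of two terminals, so at most two edges leave
  the copy, and by the cut condition the copy is the whole vertex set. The free edge at s must then
  end at a fourth terminal.\<close>

lemma closed_occurrence:
  assumes t: "t \<in> set ts" "t' \<in> set ts" "{f t, f t'} \<in> E" "{t, t'} \<notin> edge ` set ies"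
    and k: "k \<le> 4" and s: "s \<in> set ts" "s \<noteq> t" "s \<noteq> t'"
  shows "\<exists>s'\<in>set ts. s' \<notin> {t, t', s} \<and> {f s, f s'} \<in> E"
proof -
  let ?S = "f ` {..<n}"
  have tn: "t < n" "t' < n" using t ts_n by auto
  have "outer t = f t'" using outer(3)[OF t(1,3)] t(4) inner_iff[OF tn] by auto
  moreover have "outer t' = f t"
    using outer(3)[OF t(2), of "f t"] t(3,4) inner_iff[OF tn(2,1)] by (auto simp: insert_commute)
  ultimately have ot: "outer t = f t'" "outer t' = f t" .
  have tt': "t \<noteq> t'" using t(3) no_loop by auto
  have "boundary E ?S \<subseteq> (\<lambda>s. {f s, outer s}) ` (set ts - {t, t'})"
  proof
    fix e assume "e \<in> boundary E ?S"
    then have eE: "e \<in> E" and "e \<inter> ?S \<noteq> {}" and "\<not> e \<subseteq> ?S" by (auto simp: boundary_def)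
    then obtain a where a: "a < n" "f a \<in> e" by auto
    obtain w where w: "e = {f a, w}" by (rule graph_edge_other[OF graph eE a(2)])
    then have "w \<notin> ?S" using a \<open>\<not> e \<subseteq> ?S\<close> by auto
    then have ni: "\<not> inner a w" by (auto simp: inner_def)
    then have at: "a \<in> set ts" using neighbour_of_full[OF a(1)] eE w by blast
    with ni have "w = outer a" using outer(3) eE w by blast
    moreover from this \<open>w \<notin> ?S\<close> ot tn have "a \<noteq> t" "a \<noteq> t'" by auto
    ultimately show "e \<in> (\<lambda>s. {f s, outer s}) ` (set ts - {t, t'})" using at w by blast
  qed
  then have "card (boundary E ?S) \<le> card (set ts - {t, t'})"
    by (meson List.finite_set card_image_le card_mono finite_Diff finite_imageI le_trans)
  also have "\<dots> = card (set ts) - card {t, t'}" using t by (intro card_Diff_subset) auto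
  also have "\<dots> \<le> 2" using tt' k distinct_ts pole by (simp add: distinct_card pole_def)
  finally have "\<not> 3 \<le> card (boundary E ?S)" by simp
  moreover have "?S \<noteq> {}" using tn by auto
  ultimately have SV: "?S = V" using cuts f_V unfolding three_edge_connected_def by blast
  have "outer s \<in> V" using graph_edges_Pow[OF graph] outer(1)[OF s(1)] by auto
  then obtain b where b: "b < n" "outer s = f b" using SV by auto
  note ob = outer_terminal[OF s(1) b]
  \<comment> \<open>The free edges of t and t' are spent on each other, so neither can be the other
    end of the free edge at s.\<close>
  have "b \<noteq> u" if u: "u \<in> set ts" "outer u = f u'" "u' < n" "s \<noteq> u'" "s \<noteq> u" for u u'
  proof
    assume "b = u"
    then have "{f u, f s} \<in> E" using outer(1)[OF s(1)] b(2) by (simp add: insert_commute)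
    then have "f s = outer u \<or> inner u (f s)" by (rule outer(3)[OF u(1)])
    moreover have "f s \<noteq> outer u" using u f_eq_iff[OF ts_n[OF s(1)]] by simp
    moreover have "\<not> inner u (f s)"
      using ob(3) \<open>b = u\<close> inner_iff[OF ts_n[OF u(1)] ts_n[OF s(1)]] by (simp add: insert_commute)
    ultimately show False by simp
  qed
  with t ot tn s have "b \<noteq> t" "b \<noteq> t'" by blast+
  then show ?thesis using ob outer(1)[OF s(1)] b(2) by auto
qed

end

section \<open>Replacing a pole by a smaller one\<close>

lemma count_list_filter: "count_list ys y + length (filter (\<lambda>z. z \<noteq> y) ys) = length ys"
  by (induction ys) auto

context attached
begin

lemma length_zip_crossing:
  assumes "length us = length zs" "\<And>u. u \<in> set us \<Longrightarrow> u \<in> S \<longleftrightarrow> b"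
  shows "length (filter (\<lambda>(a, b). (a \<in> S) \<noteq> (b \<in> S)) (zip us zs)) = length (filter (\<lambda>z. (z \<in> S) \<noteq> b) zs)"
  using assms by (induction us zs rule: list_induct2) auto

lemma crossing_links:
  assumes "\<And>a. a < n \<Longrightarrow> f a \<in> S \<longleftrightarrow> b"
  shows "length (filter (\<lambda>(a, b). (a \<in> S) \<noteq> (b \<in> S)) L) = length (filter (\<lambda>y. (y \<in> S) \<noteq> b) ys)"
proof -
  have "filter (\<lambda>(a, b). (a \<in> S) \<noteq> (b \<in> S)) (map (map_prod f f) ies) = []"
    unfolding filter_empty_conv using assms ies_n by fastforce
  moreover have "length (filter (\<lambda>(a, b). (a \<in> S) \<noteq> (b \<in> S)) (zip (map f ts) ys)) =
    length (filter (\<lambda>y. (y \<in> S) \<noteq> b) ys)"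
    using assms ts_n length_ts by (intro length_zip_crossing) auto
  ultimately show ?thesis by (simp add: links_def)
qed

text \<open>Cuts that leave the pole whole, on one side or on the other, give inequalities that
  mention only \<open>F\<close> and \<open>ys\<close>. These survive the replacement of the
  pole.\<close>

lemma outside_cuts:
  assumes cuts: "three_edge_connected (verts n) (edges ts ies)" and s: "s \<subseteq> Y"
  shows "s \<noteq> {} \<Longrightarrow> 3 \<le> card (boundary F s) + length (filter (\<lambda>y. y \<in> s) ys)"
    and "s \<noteq> Y \<Longrightarrow> 3 \<le> card (boundary F s) + length (filter (\<lambda>y. y \<notin> s) ys)"
proof -
  have f0: "f 0 \<in> verts n" "f 0 \<notin> Y" using n_pos f_notin_Y by (auto simp: verts_def)
  assume "s \<noteq> {}"
  moreover have "s \<subset> verts n" using s f0 by (auto simp: verts_def)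
  ultimately have "3 \<le> card (boundary (edges ts ies) s)" using cuts by (simp add: three_edge_connected_def)
  moreover have "s \<inter> Y = s" using s by auto
  moreover have "f a \<in> s \<longleftrightarrow> False" if "a < n" for a using that s f_notin_Y by auto
  ultimately show "3 \<le> card (boundary F s) + length (filter (\<lambda>y. y \<in> s) ys)"
    unfolding card_boundary_edges by (subst (asm) crossing_links[of s False]) auto
next
  assume "s \<noteq> Y"
  let ?S = "s \<union> f ` {..<n}"
  have "?S \<subset> verts n"
  proof -
    obtain y where "y \<in> Y" "y \<notin> s" using \<open>s \<noteq> Y\<close> s by auto
    moreover from this have "y \<notin> f ` {..<n}" using f_notin_Y by auto
    ultimately show ?thesis using s by (auto simp: verts_def)
  qed
  moreover have "?S \<noteq> {}" using n_pos by auto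
  ultimately have "3 \<le> card (boundary (edges ts ies) ?S)" using cuts by (simp add: three_edge_connected_def)
  moreover have "?S \<inter> Y = s" using s f_notin_Y by auto
  moreover have "f a \<in> ?S \<longleftrightarrow> True" if "a < n" for a using that by auto
  moreover have "filter (\<lambda>y. (y \<in> ?S) \<noteq> True) ys = filter (\<lambda>y. y \<notin> s) ys"
    using ys_Y f_notin_Y by (intro filter_cong) auto
  ultimately show "3 \<le> card (boundary F s) + length (filter (\<lambda>y. y \<notin> s) ys)"
    unfolding card_boundary_edges by (subst (asm) crossing_links[of ?S True]) auto
qed

lemma card_verts: "card (verts n) = card Y + n"
proof -
  have "inj_on f {..<n}" using inj_f n_N by (auto intro: inj_on_subset)
  moreover have "Y \<inter> f ` {..<n} = {}" using f_notin_Y by auto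
  moreover have "finite Y" using graph_F by (simp add: graph_def)
  ultimately show ?thesis by (simp add: verts_def card_Un_disjoint card_image)
qed

lemma outside_degree:
  assumes "cubic (verts n) (edges ts ies)" "y \<in> Y"
  shows "degree F y + count_list ys y = 3"
  using assms degree_edges_outer by (simp add: cubic_def verts_def)

end

locale minimal_occurrence = attached Y F ys f N n ts ies
  for Y :: "'a set" and F ys f N n ts ies +
  assumes cubic: "cubic (verts n) (edges ts ies)"
    and cuts: "three_edge_connected (verts n) (edges ts ies)"
    and minimal: "\<And>(V' :: 'a set) E'. graph V' E' \<Longrightarrow> cubic V' E' \<Longrightarrow> three_edge_connected V' E' \<Longrightarrow>
      3 < card V' \<Longrightarrow> card V' < card (verts n) \<Longrightarrow> has_3_decomposition V' E'"
begin

lemmas cut_inside = outside_cuts(1)[OF cuts] and cut_outside = outside_cuts(2)[OF cuts]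

lemmas degree_F = outside_degree[OF cubic]

lemma replace:
  assumes K: "pole (length ys) m us jes" "m < n" "distinct (zip us ys)"
    and cuts': "three_edge_connected (verts m) (edges us jes)" and "3 < card Y + m"
    and "reduces (length ys) m us jes n ts ies R W"
    and "\<And>T C M ls r. state T C M ls r \<Longrightarrow> r \<in> set (canonical (length ys)) \<Longrightarrow> r \<in> set R"
  shows "has_3_decomposition (verts n) (edges ts ies)"
proof -
  have at: "attached Y F ys f N m us jes"
    using K n_N by unfold_locales auto
  interpret K: attached Y F ys f N m us jes by (rule at)
  have "has_3_decomposition (verts m) (edges us jes)"
    using assms(5) K(2) cuts' by (intro minimal K.graph_edges K.cubic_edges degree_F) (simp_all add: card_verts K.card_verts)
  with assms(7) show ?thesis
    by (rule reduction[OF at attached_axioms assms(6)])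
qed

text \<open>Reduces the cuts of the smaller graph to a finite case distinction on which pole nodes
  and outer ends lie in S. The bounds from the larger graph require S to meet Y, respectively to
  miss part of it; the first alternatives of the two disjunctions cover the degenerate sets.\<close>

lemma three_edge_connected_edges:
  assumes K: "pole (length ys) m us jes" "m \<le> n" "distinct (zip us ys)"
    and crossing: "\<And>S.
      (\<forall>y\<in>set ys. y \<notin> S) \<and> (\<exists>a<m. f a \<in> S) \<or>
        3 \<le> card (boundary F (S \<inter> Y)) + length (filter (\<lambda>y. y \<in> S) ys) \<Longrightarrow>
      (\<forall>y\<in>set ys. y \<in> S) \<and> (\<exists>a<m. f a \<notin> S) \<or>
        3 \<le> card (boundary F (S \<inter> Y)) + length (filter (\<lambda>y. y \<notin> S) ys) \<Longrightarrow>
      3 \<le> card (boundary F (S \<inter> Y)) + length (filter (\<lambda>(a, b). (a \<in> S) \<noteq> (b \<in> S)) (links us jes))"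
  shows "three_edge_connected (verts m) (edges us jes)"
proof -
  interpret K: attached Y F ys f N m us jes using K n_N by unfold_locales auto
  show ?thesis
    unfolding three_edge_connected_def K.card_boundary_edges
  proof (intro allI impI, rule crossing)
    fix S assume S: "S \<subset> verts m" "S \<noteq> {}"
    have ys: "filter (\<lambda>y. y \<in> S \<inter> Y) ys = filter (\<lambda>y. y \<in> S) ys"
      "filter (\<lambda>y. y \<notin> S \<inter> Y) ys = filter (\<lambda>y. y \<notin> S) ys"
      using ys_Y by (auto intro!: filter_cong)
    show "(\<forall>y\<in>set ys. y \<notin> S) \<and> (\<exists>a<m. f a \<in> S) \<or>
        3 \<le> card (boundary F (S \<inter> Y)) + length (filter (\<lambda>y. y \<in> S) ys)"
    proof (cases "S \<inter> Y = {}")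
      case True
      then show ?thesis using S ys_Y by (auto simp: verts_def)
    next
      case False
      then show ?thesis using cut_inside[of "S \<inter> Y"] ys(1) by simp
    qed
    show "(\<forall>y\<in>set ys. y \<in> S) \<and> (\<exists>a<m. f a \<notin> S) \<or>
        3 \<le> card (boundary F (S \<inter> Y)) + length (filter (\<lambda>y. y \<notin> S) ys)"
    proof (cases "S \<inter> Y = Y")
      case True
      then show ?thesis using S ys_Y by (auto simp: verts_def)
    next
      case False
      then show ?thesis using cut_outside[of "S \<inter> Y"] ys(2) by simp
    qed
  qed
qed

section \<open>Simplicity and cuts of the three replacements\<close>

lemma boundary_Y_singleton: "boundary F {y} = {e \<in> F. y \<in> e}"
  using graph_F by (rule boundary_singleton)

lemma replace_by_vertex:
  assumes k: "length ys = 3" and n: "1 < n"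
    and red: "reduces 3 1 [0, 0, 0] [] n ts ies (canonical 3) W"
  shows "has_3_decomposition (verts n) (edges ts ies)"
proof -
  obtain y0 y1 y2 where ys: "ys = [y0, y1, y2]"
    using k by (auto simp: numeral_3_eq_3 length_Suc_conv)
  have yY: "y0 \<in> Y" "y1 \<in> Y" "y2 \<in> Y" using ys_Y ys by auto
  have fY: "finite Y" using graph_F by (simp add: graph_def)
  show ?thesis
  proof (cases "Y = {y0}")
    case True \<comment> \<open>the replacement would be a triple edge, e.g. in \<open>K\<^sub>4\<close>, \<open>K\<^sub>3\<^sub>,\<^sub>3\<close> or the Petersen graph itself\<close>
    then have y: "ys = [y0, y0, y0]" using ys yY by auto
    have F: "F = {}"
      using graph_F True unfolding graph_def by (metis equals0I singletonD)
    \<comment> \<open>A triple edge decomposes into one tree edge and a cycle of length two. This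
      state passes every test made by \<open>reduces\<close>, although the replacement is not
      simple, so the table still provides a continuation.\<close>
    have ex: "\<exists>w\<in>set W. upgrade [Tr, Cy, Cy] (take 3 w) \<and> spanning_ok n ts ies [0, 0, 0] w"
    proof -
      have "[Tr, Cy, Cy] \<in> set (List.n_lists 3 [Tr, Cy, Ma])" "[] \<in> set (List.n_lists (length []) [Tr, Cy, Ma])"
        "[0, 0, 0] \<in> set (canonical 3)" "locally_ok 1 (zip [0, 0, 0] (replicate 3 1) @ []) ([Tr, Cy, Cy] @ [])"
        "spanning_ok 1 [0, 0, 0] [] [0, 0, 0] ([Tr, Cy, Cy] @ [])" by code_simp+
      with red show ?thesis unfolding reduces_def by (metis (no_types, lifting))
    qed
    have st: "state {} {} {} [Tr, Cy, Cy] [0, 0, 0]"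
    proof -
      have "acyclic_edges ({} :: 'a set set)" by (simp add: acyclic_iff_bridges)
      then show ?thesis
        unfolding state_def unfolding F True y by (simp add: degree_def All_less_Suc Ex_less_Suc)
    qed
    from ex obtain w where "w \<in> set W" "upgrade [Tr, Cy, Cy] (take 3 w)" "spanning_ok n ts ies [0, 0, 0] w" by blast
    moreover from this red have "length w = 3 + length ies" "locally_ok n (zip ts (replicate 3 n) @ ies) w"
      by (auto simp: reduces_def)
    ultimately show ?thesis using decomposition_of_state[OF st] k by simp
  next
    case False
    \<comment> \<open>If y carries c dangling edges, the cut around y and the pole has (3 - c) + (3
      - c) edges. It has at least three, so c is at most one.\<close>
    have "count_list ys y \<le> 1" if "y \<in> Y" for y
    proof -
      have "Y \<noteq> {y}" using False yY(1) by auto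
      then have "3 \<le> card (boundary F {y}) + length (filter (\<lambda>z. z \<noteq> y) ys)"
        using cut_outside[of "{y}"] that by auto
      moreover have "card (boundary F {y}) = degree F y" by (simp add: boundary_Y_singleton degree_def)
      ultimately show ?thesis using degree_F[OF that] count_list_filter[of ys y] k by linarith
    qed
    from this[OF yY(1)] this[OF yY(2)] have dist: "distinct ys" by (auto simp: ys split: if_splits)
    have "card (set ys) \<le> card Y" using ys_Y fY by (rule card_mono[rotated])
    then have cardY: "3 \<le> card Y" using dist k by (simp add: distinct_card)
    have distz: "distinct (zip [0, 0, 0 :: nat] ys)" using dist by (simp add: ys)
    have pole1: "pole (length ys) 1 [0, 0, 0] []" unfolding k by code_simp
    have "three_edge_connected (verts 1) (edges [0, 0, 0] [])"
    proof (rule three_edge_connected_edges[OF pole1 _ distz])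
      fix S
    assume "(\<forall>y\<in>set ys. y \<notin> S) \<and> (\<exists>a<1. f a \<in> S) \<or>
        3 \<le> card (boundary F (S \<inter> Y)) + length (filter (\<lambda>y. y \<in> S) ys)"
      and "(\<forall>y\<in>set ys. y \<in> S) \<and> (\<exists>a<1. f a \<notin> S) \<or>
        3 \<le> card (boundary F (S \<inter> Y)) + length (filter (\<lambda>y. y \<notin> S) ys)"
    then show "3 \<le> card (boundary F (S \<inter> Y)) +
          length (filter (\<lambda>(a, b). (a \<in> S) \<noteq> (b \<in> S)) (links [0, 0, 0] []))"
        unfolding links_def unfolding ys by (cases "f 0 \<in> S") auto
    qed (use n in simp)
    from replace[OF pole1 n distz this] cardY red k show ?thesis by auto
  qed
qed

text \<open>A set splitting the 4-cycle cuts at least two of its edges. A third edge in the cut is a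
  dangling one or lies outside: if no outside edge crossed and both sides met Y, each side would
  contain three of the only four outer ends.\<close>

lemma replace_by_square:
  assumes k: "length ys = 4" and n: "4 < n"
    and red: "reduces 4 4 [0, 1, 2, 3] [(0, 1), (1, 2), (2, 3), (3, 0)] n ts ies R W"
    and R: "\<And>T C M ls r. state T C M ls r \<Longrightarrow> r \<in> set (canonical 4) \<Longrightarrow> r \<in> set R"
  shows "has_3_decomposition (verts n) (edges ts ies)"
proof -
  obtain y0 y1 y2 y3 where ys: "ys = [y0, y1, y2, y3]"
    using k by (auto simp: eval_nat_numeral length_Suc_conv)
  have pole4: "pole (length ys) 4 [0, 1, 2, 3] [(0, 1), (1, 2), (2, 3), (3, 0)]" unfolding k by code_simp
  have dist: "distinct (zip [0, 1, 2, 3 :: nat] ys)" by (rule distinct_zipI1) simp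
  have "y0 \<in> Y" "finite Y" using ys_Y graph_F by (auto simp: ys graph_def)
  then have cardY: "0 < card Y" by (auto simp: card_gt_0_iff)
  have "three_edge_connected (verts 4) (edges [0, 1, 2, 3] [(0, 1), (1, 2), (2, 3), (3, 0)])"
  proof (rule three_edge_connected_edges[OF pole4 _ dist])
    fix S
    assume "(\<forall>y\<in>set ys. y \<notin> S) \<and> (\<exists>a<4. f a \<in> S) \<or>
        3 \<le> card (boundary F (S \<inter> Y)) + length (filter (\<lambda>y. y \<in> S) ys)"
      and "(\<forall>y\<in>set ys. y \<in> S) \<and> (\<exists>a<4. f a \<notin> S) \<or>
        3 \<le> card (boundary F (S \<inter> Y)) + length (filter (\<lambda>y. y \<notin> S) ys)"
    then show "3 \<le> card (boundary F (S \<inter> Y)) + length (filter (\<lambda>(a, b). (a \<in> S) \<noteq> (b \<in> S))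
        (links [0, 1, 2, 3] [(0, 1), (1, 2), (2, 3), (3, 0)]))"
      unfolding links_def unfolding ys
      by (cases "f 0 \<in> S"; cases "f 1 \<in> S"; cases "f 2 \<in> S"; cases "f 3 \<in> S";
          auto simp add: eval_nat_numeral All_less_Suc Ex_less_Suc split: if_splits)
  qed (use n in simp)
  from replace[OF pole4 n dist this] cardY red R k show ?thesis by auto
qed

text \<open>Node 0 carries the outer ends 0 and 3, node 1 carries 1 and 2. The one critical cut
  separates these two groups with their nodes: at the pole it contains only the central edge, so
  \<open>sep\<close> has to supply two more.\<close>

lemma replace_by_H:
  assumes k: "length ys = 4" and n: "2 < n"
    and sep: "\<And>s. s \<subseteq> Y \<Longrightarrow> ys ! 0 \<in> s \<Longrightarrow> ys ! 3 \<in> s \<Longrightarrow> ys ! 1 \<notin> s \<Longrightarrow> ys ! 2 \<notin> s \<Longrightarrow>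
      2 \<le> card (boundary F s)"
    and red: "reduces 4 2 [0, 1, 1, 0] [(0, 1)] n ts ies (canonical 4) W"
  shows "has_3_decomposition (verts n) (edges ts ies)"
proof -
  obtain y0 y1 y2 y3 where ys: "ys = [y0, y1, y2, y3]"
    using k by (auto simp: eval_nat_numeral length_Suc_conv)
  have yY: "y0 \<in> Y" "y1 \<in> Y" "y2 \<in> Y" "y3 \<in> Y" and fY: "finite Y"
    using ys_Y graph_F by (auto simp: ys graph_def)
  have compl: "boundary F (Y - s) = boundary F s" if "s \<subseteq> Y" for s
    using F_subset that by (fastforce simp: boundary_def)
  have sep1: "2 \<le> card (boundary F s)" if "s \<subseteq> Y" "y0 \<in> s" "y3 \<in> s" "y1 \<notin> s" "y2 \<notin> s" for s
    using sep[of s] that by (simp add: ys)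
  have sep2: "2 \<le> card (boundary F s)" if "s \<subseteq> Y" "y1 \<in> s" "y2 \<in> s" "y0 \<notin> s" "y3 \<notin> s" for s
    using sep1[of "Y - s"] that yY compl[of s] by simp
  have single: "card (boundary F {y}) + count_list ys y = 3" if "y \<in> Y" for y
    using degree_F[OF that] by (simp add: boundary_Y_singleton degree_def)
  \<comment> \<open>With c dangling edges at y, the cut around y and the pole has (3 - c) + (4 - c)
    edges, so c is at most two.\<close>
  have few: "count_list ys y \<le> 2" if "y \<in> Y" for y
  proof (cases "Y = {y}")
    case True
    then have "ys = [y, y, y, y]" using yY by (simp add: ys)
    then show ?thesis using single[OF that] by simp
  next
    case False
    then have "3 \<le> card (boundary F {y}) + length (filter (\<lambda>z. z \<noteq> y) ys)"
      using cut_outside[of "{y}"] that by auto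
    then show ?thesis using single[OF that] count_list_filter[of ys y] k by linarith
  qed
  \<comment> \<open>If y0 carried both dangling edges of node 0, a single edge of \<open>F\<close>
    would be left there, against \<open>sep\<close> for the set of y0 alone.\<close>
  have "y0 \<noteq> y3"
  proof
    assume "y0 = y3"
    then show False
      using sep1[of "{y0}"] single[OF yY(1)] few[OF yY(1)] yY by (auto simp: ys split: if_splits)
  qed
  moreover have "y1 \<noteq> y2"
  proof
    assume "y1 = y2"
    then show False
      using sep2[of "{y1}"] single[OF yY(2)] few[OF yY(2)] yY by (auto simp: ys split: if_splits)
  qed
  ultimately have dist: "distinct (zip [0, 1, 1, 0 :: nat] ys)" by (auto simp: ys)
  have "card {y0, y3} \<le> card Y" using yY fY by (intro card_mono) auto
  then have cardY: "2 \<le> card Y" using \<open>y0 \<noteq> y3\<close> by simp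
  have poleH: "pole (length ys) 2 [0, 1, 1, 0] [(0, 1)]" unfolding k by code_simp
  have "three_edge_connected (verts 2) (edges [0, 1, 1, 0] [(0, 1)])"
  proof (rule three_edge_connected_edges[OF poleH _ dist])
    fix S
    have "2 \<le> card (boundary F (S \<inter> Y))" if "y0 \<in> S" "y3 \<in> S" "y1 \<notin> S" "y2 \<notin> S"
      using that sep1[of "S \<inter> Y"] yY by simp
    moreover have "2 \<le> card (boundary F (S \<inter> Y))" if "y1 \<in> S" "y2 \<in> S" "y0 \<notin> S" "y3 \<notin> S"
      using that sep2[of "S \<inter> Y"] yY by simp
    moreover assume "(\<forall>y\<in>set ys. y \<notin> S) \<and> (\<exists>a<2. f a \<in> S) \<or>
        3 \<le> card (boundary F (S \<inter> Y)) + length (filter (\<lambda>y. y \<in> S) ys)"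
      and "(\<forall>y\<in>set ys. y \<in> S) \<and> (\<exists>a<2. f a \<notin> S) \<or>
        3 \<le> card (boundary F (S \<inter> Y)) + length (filter (\<lambda>y. y \<notin> S) ys)"
    ultimately show "3 \<le> card (boundary F (S \<inter> Y)) + length (filter (\<lambda>(a, b). (a \<in> S) \<noteq> (b \<in> S))
        (links [0, 1, 1, 0] [(0, 1)]))"
      unfolding links_def unfolding ys
      by (cases "f 0 \<in> S"; cases "f 1 \<in> S"; cases "y0 \<in> S"; cases "y1 \<in> S";
          auto simp add: eval_nat_numeral All_less_Suc Ex_less_Suc split: if_splits)
  qed (use n in simp)
  from replace[OF poleH n dist this] cardY red k show ?thesis by auto
qed

end

lemma reach_leaves:
  assumes "reach T u v" "u \<in> s" "v \<notin> s"
  obtains a b where "{a, b} \<in> T" "a \<in> s" "b \<notin> s" "reach T u a" "reach T u b"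
proof -
  have "v \<notin> s \<longrightarrow> (\<exists>a b. {a, b} \<in> T \<and> a \<in> s \<and> b \<notin> s \<and> reach T u a \<and> reach T u b)"
    using assms(1)
  proof (induction rule: rtranclp_induct)
    case (step v w)
    have "{v, w} \<in> T" using step(2) by (simp add: adj_def)
    moreover have "reach T u w" using step(1,2) by (rule rtranclp.rtrancl_into_rtrancl)
    ultimately show ?case using step.IH step(1) by blast
  qed (use assms(2) in simp)
  with that assms(3) show thesis by blast
qed

text \<open>Two different tree components joining opposite sides of the cut would need two edges in it.\<close>

lemma (in outside) state_bridge:
  assumes st: "state T C M ls r" and k: "length ys = 4"
    and s: "ys ! 0 \<in> s" "ys ! 3 \<in> s" "ys ! 1 \<notin> s" "ys ! 2 \<notin> s" "card (boundary F s) \<le> 1"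
  shows "r \<noteq> [0, 0, 2, 2]"
proof
  assume r: "r = [0, 0, 2, 2]"
  have "T \<subseteq> F" and rr: "\<And>i j. i < 4 \<Longrightarrow> j < 4 \<Longrightarrow> r ! i = r ! j \<longleftrightarrow> reach T (ys ! i) (ys ! j)"
    using st k by (auto simp: state_def)
  have re: "reach T (ys ! 0) (ys ! 1)" "reach T (ys ! 3) (ys ! 2)" and no: "\<not> reach T (ys ! 0) (ys ! 3)"
    using rr[of 0 1] rr[of 3 2] rr[of 0 3] by (simp_all add: r)
  obtain a b where ab: "{a, b} \<in> T" "a \<in> s" "b \<notin> s" "reach T (ys ! 0) a"
    using reach_leaves[OF re(1) s(1,3)] .
  obtain c d where cd: "{c, d} \<in> T" "c \<in> s" "d \<notin> s" "reach T (ys ! 3) c"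
    using reach_leaves[OF re(2) s(2,4)] .
  have "{a, b} \<in> boundary F s" "{c, d} \<in> boundary F s"
    using ab cd \<open>T \<subseteq> F\<close> by (auto simp: boundary_def)
  moreover have "finite (boundary F s)" using finite_F by (simp add: boundary_def)
  ultimately have "{a, b} = {c, d}" using s(5) card_le_Suc0_iff_eq[of "boundary F s"] by auto
  with ab cd have "a = c" by (auto simp: doubleton_eq_iff)
  with ab(4) cd(4) no show False by (meson reach_sym rtranclp_trans)
qed

section \<open>Labellings of the configurations\<close>

text \<open>The lists of labellings were found by a computer search for small covers of all outer states.\<close>

definition labels_K3 :: "label list list" where
  "labels_K3 =
    [[Tr, Tr, Ma, Ma, Tr, Tr],
     [Tr, Ma, Tr, Tr, Tr, Ma],
     [Ma, Tr, Tr, Tr, Ma, Tr],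
     [Tr, Tr, Tr, Tr, Tr, Ma],
     [Tr, Cy, Cy, Tr, Cy, Tr],
     [Cy, Tr, Cy, Tr, Tr, Cy],
     [Cy, Cy, Tr, Cy, Tr, Tr]]"

lemma reduces_K3:
  "reduces 3 1 [0, 0, 0] [] 3 [0, 1, 2]
    [(0, 1), (1, 2), (2, 0)]
    (canonical 3) labels_K3"
  by code_simp

definition labels_K23 :: "label list list" where
  "labels_K23 =
    [[Tr, Tr, Ma, Tr, Ma, Tr, Ma, Tr, Tr],
     [Tr, Ma, Tr, Tr, Tr, Ma, Ma, Tr, Tr],
     [Ma, Tr, Tr, Tr, Tr, Ma, Tr, Ma, Tr],
     [Tr, Tr, Tr, Tr, Tr, Ma, Tr, Ma, Tr],
     [Tr, Cy, Cy, Tr, Tr, Tr, Tr, Cy, Cy],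
     [Cy, Tr, Cy, Tr, Tr, Tr, Cy, Tr, Cy],
     [Cy, Cy, Tr, Tr, Tr, Tr, Cy, Cy, Tr]]"

lemma reduces_K23:
  "reduces 3 1 [0, 0, 0] [] 5 [2, 3, 4]
    [(0, 2), (0, 3), (0, 4), (1, 2), (1, 3), (1, 4)]
    (canonical 3) labels_K23"
  by code_simp

definition labels_Petersen :: "label list list" where
  "labels_Petersen =
    [[Tr, Tr, Tr, Tr, Tr, Tr, Cy, Cy, Cy, Tr, Tr, Cy, Tr, Tr, Cy],
     [Tr, Tr, Tr, Tr, Tr, Cy, Tr, Tr, Tr, Tr, Cy, Cy, Cy, Tr, Cy],
     [Tr, Tr, Tr, Tr, Tr, Tr, Tr, Ma, Tr, Ma, Tr, Ma, Ma, Tr, Tr],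
     [Tr, Cy, Cy, Tr, Tr, Tr, Tr, Ma, Tr, Tr, Tr, Tr, Cy, Cy, Cy],
     [Cy, Tr, Cy, Tr, Tr, Tr, Tr, Cy, Cy, Tr, Tr, Tr, Cy, Ma, Tr],
     [Cy, Cy, Tr, Tr, Tr, Tr, Tr, Cy, Cy, Tr, Tr, Tr, Tr, Cy, Cy]]"

text \<open>The terminals 4, 6, 7 are the neighbours of the removed vertex 9.\<close>

lemma reduces_Petersen:
  "reduces 3 1 [0, 0, 0] [] 9 [4, 6, 7]
    [(0, 1), (1, 2), (2, 3), (3, 4), (4, 0), (0, 5), (1, 6), (2, 7), (3, 8), (5, 7), (6, 8), (8, 5)]
    (canonical 3) labels_Petersen"
  by code_simp

definition labels_ClawSquare :: "label list list" where
  "labels_ClawSquare =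
    [[Tr, Tr, Tr, Tr, Tr, Tr, Tr, Ma, Ma, Tr, Tr, Tr, Ma, Ma],
     [Tr, Tr, Tr, Tr, Tr, Cy, Tr, Tr, Tr, Cy, Cy, Tr, Cy, Cy],
     [Tr, Tr, Tr, Tr, Tr, Tr, Ma, Tr, Tr, Tr, Ma, Ma, Ma, Tr],
     [Tr, Tr, Tr, Tr, Cy, Tr, Tr, Tr, Cy, Cy, Tr, Cy, Cy, Tr],
     [Tr, Tr, Cy, Cy, Tr, Tr, Tr, Ma, Tr, Cy, Cy, Tr, Tr, Tr],
     [Tr, Cy, Cy, Tr, Tr, Tr, Tr, Ma, Cy, Cy, Tr, Tr, Tr, Tr],
     [Cy, Tr, Tr, Cy, Tr, Tr, Cy, Tr, Tr, Tr, Tr, Tr, Ma, Cy],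
     [Cy, Cy, Tr, Tr, Tr, Tr, Tr, Cy, Tr, Tr, Tr, Cy, Tr, Ma],
     [Tr, Tr, Cy, Cy, Tr, Tr, Ma, Tr, Tr, Cy, Cy, Ma, Tr, Tr],
     [Tr, Cy, Cy, Tr, Tr, Tr, Tr, Ma, Cy, Cy, Tr, Tr, Tr, Ma],
     [Cy, Tr, Tr, Cy, Tr, Tr, Tr, Cy, Cy, Tr, Cy, Cy, Tr, Tr],
     [Cy, Cy, Tr, Tr, Tr, Tr, Tr, Cy, Tr, Tr, Ma, Cy, Ma, Tr],
     [Tr, Tr, Tr, Tr, Cy, Cy, Cy, Cy, Tr, Tr, Ma, Tr, Tr, Tr],
     [Tr, Tr, Tr, Tr, Tr, Tr, Tr, Ma, Tr, Tr, Tr, Tr, Ma, Ma],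
     [Tr, Tr, Tr, Tr, Tr, Tr, Cy, Cy, Cy, Tr, Cy, Cy, Tr, Cy],
     [Tr, Cy, Tr, Cy, Tr, Tr, Tr, Ma, Cy, Tr, Cy, Tr, Ma, Tr],
     [Cy, Tr, Cy, Tr, Tr, Tr, Tr, Cy, Cy, Cy, Tr, Cy, Tr, Tr]]"

lemma reduces_ClawSquare:
  "reduces 4 4 [0, 1, 2, 3] [(0, 1), (1, 2), (2, 3), (3, 0)] 8 [3, 4, 5, 6]
    [(0, 1), (1, 2), (2, 3), (3, 0), (7, 4), (7, 5), (7, 6), (4, 0), (5, 1), (6, 2)]
    (canonical 4) labels_ClawSquare"
  by code_simp

definition labels_TwinHouse :: "label list list" where
  "labels_TwinHouse =
    [[Tr, Tr, Tr, Tr, Ma, Tr, Tr, Tr, Ma, Ma, Tr],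
     [Tr, Tr, Tr, Tr, Tr, Tr, Tr, Cy, Cy, Cy, Cy],
     [Tr, Tr, Tr, Tr, Ma, Tr, Tr, Ma, Tr, Tr, Ma],
     [Tr, Tr, Cy, Cy, Tr, Tr, Tr, Tr, Tr, Cy, Cy],
     [Tr, Cy, Cy, Tr, Tr, Tr, Cy, Tr, Tr, Cy, Tr],
     [Cy, Tr, Tr, Cy, Tr, Cy, Tr, Tr, Cy, Tr, Tr],
     [Cy, Cy, Tr, Tr, Cy, Tr, Tr, Tr, Tr, Tr, Ma],
     [Tr, Tr, Cy, Cy, Ma, Tr, Tr, Tr, Tr, Cy, Cy],
     [Tr, Cy, Cy, Tr, Tr, Tr, Cy, Tr, Ma, Cy, Tr],
     [Cy, Tr, Tr, Cy, Tr, Cy, Tr, Tr, Cy, Ma, Tr],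
     [Cy, Cy, Tr, Tr, Cy, Tr, Tr, Tr, Ma, Ma, Tr],
     [Tr, Ma, Ma, Tr, Tr, Ma, Tr, Tr, Tr, Tr, Ma],
     [Ma, Tr, Tr, Ma, Tr, Tr, Ma, Ma, Tr, Tr, Tr],
     [Ma, Ma, Tr, Tr, Tr, Tr, Tr, Tr, Ma, Ma, Tr],
     [Tr, Tr, Tr, Tr, Tr, Tr, Tr, Tr, Ma, Ma, Tr],
     [Tr, Tr, Tr, Tr, Cy, Cy, Cy, Tr, Cy, Tr, Cy],
     [Tr, Cy, Tr, Cy, Tr, Tr, Cy, Ma, Tr, Tr, Cy],
     [Cy, Tr, Cy, Tr, Tr, Cy, Tr, Cy, Tr, Tr, Ma]]"

lemma reduces_TwinHouse:
  "reduces 4 4 [0, 1, 2, 3] [(0, 1), (1, 2), (2, 3), (3, 0)] 6 [0, 1, 2, 3]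
    [(0, 1), (0, 4), (1, 5), (4, 2), (4, 3), (5, 2), (5, 3)]
    (canonical 4) labels_TwinHouse"
  by code_simp

definition labels_Domino_H :: "label list list" where
  "labels_Domino_H =
    [[Tr, Tr, Tr, Tr, Tr, Tr, Tr, Tr, Ma, Ma, Ma],
     [Tr, Tr, Tr, Tr, Tr, Cy, Tr, Cy, Tr, Cy, Cy],
     [Tr, Tr, Tr, Tr, Tr, Ma, Tr, Ma, Ma, Tr, Tr],
     [Tr, Tr, Tr, Tr, Cy, Tr, Cy, Tr, Cy, Cy, Tr],
     [Tr, Cy, Cy, Tr, Tr, Tr, Cy, Cy, Tr, Tr, Tr],
     [Cy, Tr, Tr, Cy, Cy, Cy, Tr, Tr, Tr, Tr, Tr],
     [Tr, Cy, Cy, Tr, Tr, Ma, Cy, Cy, Tr, Tr, Tr],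
     [Cy, Tr, Tr, Cy, Cy, Cy, Tr, Ma, Tr, Tr, Tr],
     [Tr, Tr, Tr, Tr, Tr, Tr, Tr, Tr, Tr, Ma, Ma],
     [Tr, Tr, Cy, Cy, Tr, Tr, Tr, Tr, Ma, Ma, Cy],
     [Tr, Cy, Tr, Cy, Tr, Tr, Cy, Cy, Tr, Tr, Cy],
     [Tr, Ma, Tr, Ma, Ma, Tr, Tr, Ma, Tr, Tr, Tr],
     [Cy, Tr, Cy, Tr, Tr, Tr, Cy, Cy, Cy, Tr, Tr],
     [Cy, Cy, Tr, Tr, Tr, Tr, Tr, Tr, Cy, Ma, Ma],
     [Ma, Tr, Ma, Tr, Tr, Ma, Ma, Tr, Tr, Tr, Tr]]"

text \<open>The corners are listed around the perimeter. Node 0 of the H therefore receives the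
  corners 0 and 2, the ends of one long side, and node 1 receives 3 and 5.\<close>

lemma reduces_Domino_H:
  "reduces 4 2 [0, 1, 1, 0] [(0, 1)] 6 [0, 3, 5, 2]
    [(0, 1), (1, 2), (3, 4), (4, 5), (0, 3), (1, 4), (2, 5)]
    (canonical 4) labels_Domino_H"
  by code_simp

definition labels_Domino_square :: "label list list" where
  "labels_Domino_square =
    [[Tr, Tr, Tr, Tr, Tr, Tr, Tr, Tr, Ma, Ma, Ma],
     [Tr, Tr, Tr, Tr, Tr, Cy, Tr, Cy, Tr, Cy, Cy],
     [Tr, Tr, Tr, Tr, Tr, Ma, Tr, Ma, Ma, Tr, Tr],
     [Tr, Tr, Tr, Tr, Cy, Tr, Cy, Tr, Cy, Cy, Tr],
     [Tr, Tr, Cy, Cy, Tr, Tr, Tr, Tr, Tr, Ma, Cy],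
     [Cy, Cy, Tr, Tr, Tr, Tr, Tr, Tr, Cy, Tr, Ma],
     [Tr, Tr, Cy, Cy, Tr, Tr, Tr, Tr, Ma, Ma, Cy],
     [Tr, Cy, Cy, Tr, Tr, Tr, Cy, Cy, Tr, Tr, Tr],
     [Tr, Cy, Cy, Tr, Tr, Ma, Cy, Cy, Tr, Tr, Tr],
     [Cy, Tr, Tr, Cy, Cy, Cy, Tr, Tr, Tr, Tr, Tr],
     [Cy, Tr, Tr, Cy, Cy, Cy, Tr, Ma, Tr, Tr, Tr],
     [Cy, Cy, Tr, Tr, Tr, Tr, Tr, Tr, Cy, Ma, Ma],
     [Tr, Tr, Tr, Tr, Tr, Tr, Tr, Tr, Tr, Ma, Ma],
     [Tr, Tr, Tr, Tr, Tr, Cy, Tr, Cy, Ma, Cy, Cy],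
     [Tr, Cy, Tr, Cy, Tr, Tr, Cy, Cy, Tr, Tr, Cy],
     [Cy, Tr, Cy, Tr, Tr, Tr, Cy, Cy, Cy, Tr, Tr]]"

text \<open>The omitted partition joins the two ends of each short side, 0 with 3 and 5 with 2, in
  two different outer components.\<close>

lemma reduces_Domino_square:
  "reduces 4 4 [0, 1, 2, 3] [(0, 1), (1, 2), (2, 3), (3, 0)] 6 [0, 3, 5, 2]
    [(0, 1), (1, 2), (3, 4), (4, 5), (0, 3), (1, 4), (2, 5)]
    (filter (\<lambda>r. r \<noteq> [0, 0, 2, 2]) (canonical 4)) labels_Domino_square"
  by code_simp

section \<open>The six configurations\<close>

text \<open>In a triangle-free graph, two terminals with a common neighbour in the configuration
  cannot be adjacent. \<open>X\<close> collects the pairs to which this does not apply and which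
  need an argument of their own.\<close>

definition nonadjacent_terminals :: "nat \<Rightarrow> nat list \<Rightarrow> (nat \<times> nat) list \<Rightarrow> nat set set \<Rightarrow> bool" where
  "nonadjacent_terminals n ts ies X \<longleftrightarrow> (\<forall>t\<in>set ts. \<forall>t'\<in>set ts.
     t = t' \<or> {t, t'} \<in> edge ` set ies \<or> {t, t'} \<in> X \<or>
     (\<exists>c\<in>set [0..<n]. {t, c} \<in> edge ` set ies \<and> {t', c} \<in> edge ` set ies))"

lemma contains_subgraph_mono:
  assumes "D \<subseteq> D'" "contains_subgraph V E V' D'"
  shows "contains_subgraph V E V' D"
proof -
  from assms(2) obtain f where "inj_on f V'" "f ` V' \<subseteq> V" "\<forall>e\<in>D'. f ` e \<in> E"
    unfolding contains_subgraph_def by meson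
  with assms(1) show ?thesis unfolding contains_subgraph_def by (intro exI[of _ f]) auto
qed

lemma contains_mk_edges:
  assumes "contains_subgraph V E V' (mk_edges ps)"
  obtains f where "inj_on f V'" "f ` V' \<subseteq> V" "\<forall>(a, b)\<in>set ps. {f a, f b} \<in> E"
proof -
  from assms obtain f where f: "inj_on f V'" "f ` V' \<subseteq> V" "\<forall>e\<in>mk_edges ps. f ` e \<in> E"
    by (auto simp: contains_subgraph_def)
  have "{f a, f b} \<in> E" if "(a, b) \<in> set ps" for a b
  proof -
    have "{a, b} \<in> mk_edges ps" using that by (force simp: mk_edges_def)
    with f(3) show ?thesis by force
  qed
  with f(1,2) show thesis by (intro that) auto
qed

locale minimal_counterexample =
  fixes V :: "'a set" and E :: "'a set set"
  assumes graph: "graph V E" and cubic: "cubic V E" and cuts: "three_edge_connected V E"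
    and minimal: "\<And>(V' :: 'a set) E'. graph V' E' \<Longrightarrow> cubic V' E' \<Longrightarrow> three_edge_connected V' E' \<Longrightarrow>
      3 < card V' \<Longrightarrow> card V' < card V \<Longrightarrow> has_3_decomposition V' E'"
    and no_decomposition: "\<not> has_3_decomposition V E"
begin

lemma no_loop: "{v, v} \<notin> E"
  using graph unfolding graph_def by fastforce

lemma edge_in_V: "{u, v} \<in> E \<Longrightarrow> u \<in> V \<and> v \<in> V"
  using graph_edges_Pow[OF graph] by auto

definition copy :: "(nat \<Rightarrow> 'a) \<Rightarrow> nat \<Rightarrow> (nat \<times> nat) list \<Rightarrow> bool" where
  "copy f n ies \<longleftrightarrow> inj_on f {..<n} \<and> f ` {..<n} \<subseteq> V \<and> (\<forall>(a, b)\<in>set ies. {f a, f b} \<in> E)"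

lemma copy_eq_iff: "copy f n ies \<Longrightarrow> a < n \<Longrightarrow> b < n \<Longrightarrow> f a = f b \<longleftrightarrow> a = b"
  by (auto simp: copy_def inj_on_def)

lemma copy_edge:
  assumes "copy f n ies" "{a, b} \<in> edge ` set ies"
  shows "{f a, f b} \<in> E"
proof -
  from assms(2) obtain x y where "(x, y) \<in> set ies" "{x, y} = {a, b}" by force
  with assms(1) show ?thesis by (auto simp: copy_def doubleton_eq_iff insert_commute)
qed

lemma occurrence_copy:
  assumes "copy f n ies" "pole k n ts ies" "distinct ts"
  shows "occurrence V E f k n ts ies"
  using assms graph cubic cuts by unfold_locales (auto simp: copy_def)

lemma irreducible:
  assumes occ: "copy f n ies" "pole k n ts ies" "distinct ts"
    and no_extra: "\<And>t t'. t \<in> set ts \<Longrightarrow> t' \<in> set ts \<Longrightarrow> t \<noteq> t' \<Longrightarrow> {f t, f t'} \<in> E \<Longrightarrow> {t, t'} \<in> edge ` set ies"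
    and step: "\<And>Y F ys. minimal_occurrence Y F ys f n n ts ies \<Longrightarrow> length ys = k \<Longrightarrow>
      has_3_decomposition (outside.verts Y f n) (outside.edges F ys f ts ies)"
  shows False
proof -
  interpret occurrence V E f k n ts ies using occ by (rule occurrence_copy)
  obtain Y F ys where at: "attached Y F ys f n n ts ies" and V: "V = outside.verts Y f n"
    and E: "E = outside.edges F ys f ts ies" and k: "length ys = k"
    using attached_occurrence[OF no_extra] by blast
  have "minimal_occurrence Y F ys f n n ts ies"
    using at cubic cuts minimal unfolding minimal_occurrence_def minimal_occurrence_axioms_def V[symmetric] E[symmetric]
    by blast
  from step[OF this k] show False using no_decomposition V E by simp
qed

text \<open>Any two terminals are already joined inside the triangle, so no extra edge is possible,
  and triangle-freeness is available from here on.\<close>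

lemma no_triangle_copy: "\<not> copy f 3 [(0, 1), (1, 2), (2, 0)]"
proof
  assume c: "copy f 3 [(0, 1), (1, 2), (2, 0)]"
  show False
  proof (rule irreducible[OF c, of 3 "[0, 1, 2]"])
    show "pole 3 3 [0, 1, 2] [(0, 1), (1, 2), (2, 0)]" by code_simp
    show "{t, t'} \<in> edge ` set [(0, 1), (1, 2), (2, 0)]"
      if "t \<in> set [0, 1, 2]" "t' \<in> set [0, 1, 2]" "t \<noteq> t'" for t t' :: nat
      using that by (auto simp: insert_commute)
    show "has_3_decomposition (outside.verts Y f 3) (outside.edges F ys f [0, 1, 2] [(0, 1), (1, 2), (2, 0)])"
      if "minimal_occurrence Y F ys f 3 3 [0, 1, 2] [(0, 1), (1, 2), (2, 0)]" "length ys = 3" for Y F ys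
      using minimal_occurrence.replace_by_vertex[OF that _ reduces_K3] by simp
  qed simp
qed

lemma no_triangle:
  assumes "{a, b} \<in> E" "{a, c} \<in> E"
  shows "{b, c} \<notin> E"
proof
  assume "{b, c} \<in> E"
  with assms have "a \<noteq> b" "a \<noteq> c" "b \<noteq> c" using no_loop by auto
  moreover have "a \<in> V" "b \<in> V" "c \<in> V" using assms edge_in_V by blast+
  ultimately have "copy (\<lambda>i. [a, b, c] ! i) 3 [(0, 1), (1, 2), (2, 0)]"
    using assms \<open>{b, c} \<in> E\<close>
    by (auto simp: copy_def inj_on_def insert_commute less_Suc_eq numeral_3_eq_3)
  with no_triangle_copy show False by blast
qed

lemma terminals:
  assumes c: "copy f n ies" and na: "nonadjacent_terminals n ts ies X"
    and t: "t \<in> set ts" "t' \<in> set ts" "t \<noteq> t'" "{f t, f t'} \<in> E"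
  shows "{t, t'} \<in> edge ` set ies \<or> {t, t'} \<in> X"
proof (rule ccontr)
  assume "\<not> ?thesis"
  with na t obtain x where "{t, x} \<in> edge ` set ies" "{t', x} \<in> edge ` set ies"
    unfolding nonadjacent_terminals_def by blast
  then have "{f x, f t} \<in> E" "{f x, f t'} \<in> E" using copy_edge[OF c] by (auto simp: insert_commute)
  with no_triangle t(4) show False by blast
qed

text \<open>An extra edge between two of three terminals would make the copy the whole graph, and
  the free edge of the third terminal would have no end left.\<close>

lemma irreducible_3:
  assumes c: "copy f n ies" and p: "pole 3 n ts ies" "distinct ts" "1 < n"
    and red: "reduces 3 1 [0, 0, 0] [] n ts ies (canonical 3) W"
  shows False
proof (rule irreducible[OF c p(1,2)])
  interpret occurrence V E f 3 n ts ies using c p(1,2) by (rule occurrence_copy)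
  fix t t' assume t: "t \<in> set ts" "t' \<in> set ts" "t \<noteq> t'" "{f t, f t'} \<in> E"
  show "{t, t'} \<in> edge ` set ies"
  proof (rule ccontr)
    assume e: "{t, t'} \<notin> edge ` set ies"
    have "card (set ts) = 3" using p by (simp add: distinct_card pole_def)
    then have "card (set ts - {t, t'}) = 1" using t by (simp add: card_Diff_subset)
    then obtain s where s: "set ts - {t, t'} = {s}" by (auto simp: card_1_singleton_iff)
    then obtain s' where "s' \<in> set ts" "s' \<notin> {t, t', s}"
      using closed_occurrence[OF t(1,2,4) e, of s] by auto
    with s show False by auto
  qed
next
  fix Y F ys
  assume "minimal_occurrence Y F ys f n n ts ies" "length ys = 3"
  then show "has_3_decomposition (outside.verts Y f n) (outside.edges F ys f ts ies)"
    using p(3) red by (rule minimal_occurrence.replace_by_vertex)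
qed

lemma no_K23: "\<not> copy f 5 [(0, 2), (0, 3), (0, 4), (1, 2), (1, 3), (1, 4)]"
proof
  assume c: "copy f 5 [(0, 2), (0, 3), (0, 4), (1, 2), (1, 3), (1, 4)]"
  have p: "pole 3 5 [2, 3, 4] [(0, 2), (0, 3), (0, 4), (1, 2), (1, 3), (1, 4)]" by code_simp
  show False by (rule irreducible_3[OF c p _ _ reduces_K23]) auto
qed

lemma no_Petersen_minus: "\<not> copy f 9 [(0, 1), (1, 2), (2, 3), (3, 4), (4, 0), (0, 5), (1, 6), (2, 7), (3, 8), (5, 7), (6, 8), (8, 5)]"
  (is "\<not> copy f 9 ?P")
proof
  assume c: "copy f 9 ?P"
  have p: "pole 3 9 [4, 6, 7] ?P" by code_simp
  show False by (rule irreducible_3[OF c p _ _ reduces_Petersen]) auto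
qed

text \<open>The absence of K_{2,3} in the form that rules out extra edges between terminals.\<close>

lemma no_common_neighbours:
  assumes "{u, x} \<in> E" "{u, y} \<in> E" "{u, z} \<in> E" "{v, x} \<in> E" "{v, y} \<in> E" "{v, z} \<in> E"
    and "u \<noteq> v" "x \<noteq> y" "x \<noteq> z" "y \<noteq> z"
  shows False
proof -
  have "u \<noteq> x" "u \<noteq> y" "u \<noteq> z" "v \<noteq> x" "v \<noteq> y" "v \<noteq> z" using assms(1-6) no_loop by auto
  moreover have "u \<in> V" "v \<in> V" "x \<in> V" "y \<in> V" "z \<in> V" using assms edge_in_V by blast+
  ultimately have "copy (\<lambda>i. [u, v, x, y, z] ! i) 5 [(0, 2), (0, 3), (0, 4), (1, 2), (1, 3), (1, 4)]"
    using assms by (auto simp: copy_def inj_on_def less_Suc_eq eval_nat_numeral)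
  with no_K23 show False by blast
qed

lemma irreducible_4:
  assumes c: "copy f n ies" and p: "pole 4 n ts ies" "distinct ts" "4 < n"
    and na: "nonadjacent_terminals n ts ies X"
    and X: "\<And>t t'. t \<in> set ts \<Longrightarrow> t' \<in> set ts \<Longrightarrow> {t, t'} \<in> X \<Longrightarrow> {f t, f t'} \<notin> E"
    and red: "reduces 4 4 [0, 1, 2, 3] [(0, 1), (1, 2), (2, 3), (3, 0)] n ts ies (canonical 4) W"
  shows False
proof (rule irreducible[OF c p(1,2)])
  show "{t, t'} \<in> edge ` set ies" if "t \<in> set ts" "t' \<in> set ts" "t \<noteq> t'" "{f t, f t'} \<in> E" for t t'
    using terminals[OF c na that] X that by blast
  show "has_3_decomposition (outside.verts Y f n) (outside.edges F ys f ts ies)"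
    if "minimal_occurrence Y F ys f n n ts ies" "length ys = 4" for Y F ys
    using minimal_occurrence.replace_by_square[OF that p(3) red] by blast
qed

lemma no_claw_square:
  "\<not> copy f 8 [(0, 1), (1, 2), (2, 3), (3, 0), (7, 4), (7, 5), (7, 6), (4, 0), (5, 1), (6, 2)]"
  (is "\<not> copy f 8 ?P")
proof
  assume c: "copy f 8 ?P"
  have p: "pole 4 8 [3, 4, 5, 6] ?P" by code_simp
  \<comment> \<open>Only the fourth corner of the square and the opposite arm of the claw lack a
    common neighbour. An edge between them would give the corners 1 and 3 the three common
    neighbours 0, 2 and 5.\<close>
  have na: "nonadjacent_terminals 8 [3, 4, 5, 6] ?P {{3, 5}}" by code_simp
  have "{f 3, f 5} \<notin> E"
  proof
    assume "{f 3, f 5} \<in> E"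
    moreover have "f 1 \<noteq> f 3" "f 0 \<noteq> f 2" "f 0 \<noteq> f 5" "f 2 \<noteq> f 5"
      by (simp_all add: copy_eq_iff[OF c])
    ultimately show False using no_common_neighbours[of "f 1" "f 0" "f 2" "f 5" "f 3"] c
      by (auto simp: copy_def insert_commute)
  qed
  then show False
    by (intro irreducible_4[OF c p _ _ na _ reduces_ClawSquare]) (auto simp: doubleton_eq_iff insert_commute)
qed

lemma no_twin_house: "\<not> copy f 6 [(0, 1), (0, 4), (1, 5), (4, 2), (4, 3), (5, 2), (5, 3)]"
  (is "\<not> copy f 6 ?P")
proof
  assume c: "copy f 6 ?P"
  have p: "pole 4 6 [0, 1, 2, 3] ?P" by code_simp
  \<comment> \<open>Triangle-freeness suffices here: all pairs of terminals are joined in the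
    configuration or have a common neighbour in it.\<close>
  have na: "nonadjacent_terminals 6 [0, 1, 2, 3] ?P {}" by code_simp
  show False
    by (rule irreducible_4[OF c p _ _ na _ reduces_TwinHouse]) auto
qed

text \<open>The square fails only for the partition \<^term>\<open>[0, 0, 2, 2 :: nat]\<close>, and an H whose two nodes keep the ends of
  the long sides works for every partition but may destroy 3-connectivity. The latter happens only at
  a separating edge, and then the bad partition cannot occur.\<close>

lemma no_domino: "\<not> copy f 6 [(0, 1), (1, 2), (3, 4), (4, 5), (0, 3), (1, 4), (2, 5)]"
  (is "\<not> copy f 6 ?P")
proof
  assume c: "copy f 6 ?P"
  have p: "pole 4 6 [0, 3, 5, 2] ?P" by code_simp
  have d: "distinct [0, 3, 5, 2 :: nat]" by simp
  \<comment> \<open>The remaining pairs are the diagonally opposite corners.\<close>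
  have na: "nonadjacent_terminals 6 [0, 3, 5, 2] ?P {{0, 5}, {2, 3}}" by code_simp
  interpret occurrence V E f 4 6 "[0, 3, 5, 2]" ?P using c p d by (rule occurrence_copy)
  have diff: "f 0 \<noteq> f 2" "f 1 \<noteq> f 3" "f 1 \<noteq> f 5" "f 3 \<noteq> f 5" "f 4 \<noteq> f 0" "f 4 \<noteq> f 2"
    by (simp_all add: copy_eq_iff[OF c])
  have K33: False \<comment> \<open>both missing edges turn the domino into \<open>K\<^sub>3\<^sub>,\<^sub>3\<close>\<close>
    if "{f 0, f 5} \<in> E" "{f 2, f 3} \<in> E"
    using no_common_neighbours[of "f 0" "f 1" "f 3" "f 5" "f 2"] diff that c
    by (auto simp: copy_def insert_commute)
  \<comment> \<open>One diagonal makes the copy the whole graph and thereby forces the other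
    diagonal.\<close>
  have e05: "{f 0, f 5} \<notin> E"
  proof
    assume e: "{f 0, f 5} \<in> E"
    have "\<exists>s'\<in>set [0, 3, 5, 2]. s' \<notin> {0, 5, 2} \<and> {f 2, f s'} \<in> E"
      using e by (intro closed_occurrence) (auto simp: doubleton_eq_iff)
    with K33[OF e] show False by auto
  qed
  have e23: "{f 2, f 3} \<notin> E"
  proof
    assume e: "{f 2, f 3} \<in> E"
    have "\<exists>s'\<in>set [0, 3, 5, 2]. s' \<notin> {2, 3, 0} \<and> {f 0, f s'} \<in> E"
      using e by (intro closed_occurrence) (auto simp: doubleton_eq_iff)
    with K33[OF _ e] show False by auto
  qed
  show False
  proof (rule irreducible[OF c p d])
    show "{t, t'} \<in> edge ` set ?P"
      if "t \<in> set [0, 3, 5, 2]" "t' \<in> set [0, 3, 5, 2]" "t \<noteq> t'" "{f t, f t'} \<in> E" for t t'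
    proof -
      have "f ` {t, t'} \<in> E" using that(4) by simp
      moreover have "f ` {0, 5} \<notin> E" "f ` {2, 3} \<notin> E" using e05 e23 by simp_all
      ultimately have "{t, t'} \<notin> {{0, 5}, {2, 3}}" by (metis insertE empty_iff)
      with terminals[OF c na that] show ?thesis by blast
    qed
    fix Y F ys
    assume mo: "minimal_occurrence Y F ys f 6 6 [0, 3, 5, 2] ?P" and k: "length ys = 4"
    interpret minimal_occurrence Y F ys f 6 6 "[0, 3, 5, 2]" ?P by (rule mo)
    show "has_3_decomposition (verts 6) (edges [0, 3, 5, 2] ?P)"
    proof (cases "\<exists>s. ys ! 0 \<in> s \<and> ys ! 3 \<in> s \<and> ys ! 1 \<notin> s \<and> ys ! 2 \<notin> s \<and> card (boundary F s) \<le> 1")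
      case True
      then have "r \<noteq> [0, 0, 2, 2]" if "state T C M ls r" for T C M ls r
        using state_bridge[OF that k] by blast
      then show ?thesis
        by (intro replace_by_square[OF k _ reduces_Domino_square]) auto
    next
      case no_bridge: False
      have "2 \<le> card (boundary F s)"
        if "ys ! 0 \<in> s" "ys ! 3 \<in> s" "ys ! 1 \<notin> s" "ys ! 2 \<notin> s" for s
      proof (rule ccontr)
        assume "\<not> ?thesis"
        then have "card (boundary F s) \<le> 1" by simp
        with that no_bridge show False by blast
      qed
      then show ?thesis
        by (intro replace_by_H[OF k _ _ reduces_Domino_H]) auto
    qed
  qed
qed

end

theorem theorem4:
  fixes V :: "'a set" and E :: "'a set set"
  assumes "graph V E" and "cubic V E" and "k_connected 3 V E"
    and "\<not> has_3_decomposition V E"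
    and "\<forall>(V' :: nat set) E'. graph V' E' \<and> cubic V' E' \<and> k_connected 3 V' E' \<and>
            \<not> has_3_decomposition V' E' \<longrightarrow> card V \<le> card V'"
  shows "\<not> contains_subgraph V E K3_V K3_E \<and>
         \<not> contains_subgraph V E K23_V K23_E \<and>
         \<not> contains_subgraph V E PetersenMinus_V PetersenMinus_E \<and>
         \<not> contains_subgraph V E ClawSquare_V ClawSquare_E \<and>
         \<not> contains_subgraph V E TwinHouse_V TwinHouse_E \<and>
         \<not> contains_subgraph V E Domino_V Domino_E"
proof -
  interpret minimal_counterexample V E
    using assms(1,2,4) k_connected_imp_three_edge_connected[OF assms(1-3)] smaller_has_decomposition[OF assms(5)]
    by unfold_locales auto
  have free: "\<not> contains_subgraph V E V' (mk_edges ps)"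
    if V': "V' = {..<n}" and no_copy: "\<And>f. \<not> copy f n ps" for V' n ps
  proof
    assume "contains_subgraph V E V' (mk_edges ps)"
    then obtain f where "inj_on f V'" "f ` V' \<subseteq> V" "\<forall>(a, b)\<in>set ps. {f a, f b} \<in> E"
      by (rule contains_mk_edges)
    then have "copy f n ps" by (simp add: copy_def V')
    with no_copy show False by blast
  qed
  have "\<not> contains_subgraph V E K3_V K3_E"
    unfolding K3_E_def by (rule free[OF _ no_triangle_copy]) (auto simp: K3_V_def)
  moreover have "\<not> contains_subgraph V E K23_V K23_E"
    unfolding K23_E_def by (rule free[OF _ no_K23]) (auto simp: K23_V_def)
  moreover have "\<not> contains_subgraph V E PetersenMinus_V PetersenMinus_E"
  proof -
    let ?P = "[(0, 1), (1, 2), (2, 3), (3, 4), (4, 0), (0, 5), (1, 6), (2, 7), (3, 8), (5, 7), (6, 8), (8, 5)]"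
    have "mk_edges ?P \<subseteq> PetersenMinus_E" by code_simp
    moreover have "\<not> contains_subgraph V E PetersenMinus_V (mk_edges ?P)"
      by (rule free[OF _ no_Petersen_minus]) (auto simp: PetersenMinus_V_def Petersen_V_def)
    ultimately show ?thesis using contains_subgraph_mono by blast
  qed
  moreover have "\<not> contains_subgraph V E ClawSquare_V ClawSquare_E"
    unfolding ClawSquare_E_def by (rule free[OF _ no_claw_square]) (auto simp: ClawSquare_V_def)
  moreover have "\<not> contains_subgraph V E TwinHouse_V TwinHouse_E"
  proof
    assume "contains_subgraph V E TwinHouse_V TwinHouse_E"
    then obtain f where f: "inj_on f TwinHouse_V" "f ` TwinHouse_V \<subseteq> V"
      "\<forall>(a, b)\<in>set [(1, 2), (1, 5), (2, 6), (5, 3), (5, 4), (6, 3), (6, 4)]. {f a, f b} \<in> E"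
      unfolding TwinHouse_E_def by (rule contains_mk_edges)
    \<comment> \<open>The twin-house is numbered from 1 whereas poles are numbered from 0, hence the
      shift by \<open>Suc\<close>.\<close>
    have V: "TwinHouse_V = Suc ` {..<6}"
      by (auto simp: TwinHouse_V_def image_Suc_lessThan)
    have "inj_on (f \<circ> Suc) {..<6}" using f(1) unfolding V by (intro comp_inj_on) auto
    moreover have "(f \<circ> Suc) ` {..<6} \<subseteq> V" using f(2) unfolding V image_comp .
    ultimately have "copy (f \<circ> Suc) 6 [(0, 1), (0, 4), (1, 5), (4, 2), (4, 3), (5, 2), (5, 3)]"
      using f(3) by (simp add: copy_def eval_nat_numeral)
    with no_twin_house show False by blast
  qed
  moreover have "\<not> contains_subgraph V E Domino_V Domino_E"
    unfolding Domino_E_def by (rule free[OF _ no_domino]) (auto simp: Domino_V_def)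
  ultimately show ?thesis by blast
qed

end
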